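(* Let $r,k,\ell\in\mathbb{N}$, let $\widehat A_1,\dots,\widehat A_k,\widehat B_1,\dots,\widehat B_\ell\in M_r(\mathbb{C})$ be fixed, and let $P$ be a polynomial over $\mathbb{C}$ in $k+\ell$ noncommuting indeterminates without constant term. For $N\ge 2r$ let $U=U^{(N)}$ be an $N\times N$ Haar unitary random matrix and let $$A_i=\begin{pmatrix}\widehat A_i&0\\0&0\end{pmatrix}\in M_N(\mathbb{C}),\qquad B_j=\begin{pmatrix}\widehat B_j&0\\0&0\end{pmatrix}\in M_N(\mathbb{C}).$$ Then the matrix $$P(A_1U^*,\dots,A_kU^*,UB_1,\dots,UB_\ell)$$ has $N-2r$ zero eigenvalues (the trivial eigenvalues), counted with multiplicity, and the other $2r$ eigenvalues, namely the nontrivial eigenvalues defined in the context (some of which may also be zero), converge almost surely, as $N\to\infty$ and under a suitable labeling, to deterministic numbers. These deterministic limits are computed by the algorithm described in the context.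
   Context: The number $r$ is fixed, $N$ is always taken sufficiently large (in particular $N\ge 2r$), and the random matrices $U^{(N)}$, for all $N$, are defined on a common probability space. $\mathbb{N}=\{1,2,\dots\}$, $[n]=\{1,\dots,n\}$. Eigenvalues are counted with algebraic multiplicity. Nontrivial eigenvalues. Write $U^{(N)}=(u_{ij})_{i,j\in[N]}$, let $\widehat U=(u_{ij})_{i,j\in[r]}$ be its upper-left $r\times r$ truncation, let $u_i$ be the $i$-th column of $U^{(N)}$ and $e_i$ the $i$-th standard basis vector of $\mathbb{C}^N$. Almost surely $\mathbf{B}=(e_1,\dots,e_r,u_1,\dots,u_r,e_{r+1},\dots,e_{N-r})$ is a basis of $\mathbb{C}^N$. With respect to $\mathbf B$, the matrix $P(A_1U^*,\dots,A_kU^*,UB_1,\dots,UB_\ell)$ is represented by a matrix whose last $N-2r$ rows vanish. The nontrivial eigenvalues are the $2r$ eigenvalues of the upper-left $2r\times 2r$ block of this representing matrix; this block equals $P(a_1,\dots,a_k,b_1,\dots,b_\ell)$ with $$a_i=\begin{pmatrix}\widehat A_i\widehat U^*&\widehat A_i\\0&0\end{pmatrix},\qquad b_j=\begin{pmatrix}0&0\\ \widehat B_j&\widehat B_j\widehat U\end{pmatrix}\in M_{2r}(\mathbb{C}).$$ The trivial eigenvalues are the remaining $N-2r$ eigenvalues. Algorithm for the limits. The block above can be written $\tilde M+\tilde V$, where $\tilde M\in M_{2r}(\mathbb{C})$ is the deterministic part not containing $\widehat U,\widehat U^*$ (that is, the matrix obtained by replacing $\widehat U$ by $0$ in the formula above),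 and the entries of $\tilde V$ are polynomials in the entries of $\widehat U,\widehat U^*$ without constant term. The limits are the $2r$ eigenvalues of $\tilde M$. *)

theory Defs
  imports
    "HOL-Probability.Probability"
    "HOL-Library.Poly_Mapping"
    "HOL-Computational_Algebra.Computational_Algebra"
    "Jordan_Normal_Form.Char_Poly"
    "Jordan_Normal_Form.Schur_Decomposition"
    "Jordan_Normal_Form.Gauss_Jordan_Elimination"
begin

(* All indices of matrices, vectors and sequences start at 0. *)

section \<open>Haar unitary random matrices\<close>

definition unitary_group :: "nat \<Rightarrow> complex mat set" where
  "unitary_group n =
     {V \<in> carrier_mat n n. V * mat_adjoint V = 1\<^sub>m n \<and> mat_adjoint V * V = 1\<^sub>m n}"

(* The Borel sigma-algebra of the unitary group, i.e. the one generated by the entries. *)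
definition unitary_borel :: "nat \<Rightarrow> complex mat measure" where
  "unitary_borel n =
     vimage_algebra (unitary_group n) (\<lambda>V. \<lambda>ij\<in>{..<n} \<times> {..<n}. V $$ ij)
       (Pi\<^sub>M ({..<n} \<times> {..<n}) (\<lambda>_. borel))"

definition haar_unitary_measure :: "nat \<Rightarrow> complex mat measure \<Rightarrow> bool" where
  "haar_unitary_measure n \<mu> \<longleftrightarrow>
     prob_space \<mu> \<and> sets \<mu> = sets (unitary_borel n) \<and>
     (\<forall>V\<in>unitary_group n. distr \<mu> (unitary_borel n) (\<lambda>W. V * W) = \<mu>)"

definition haar_unitary_rv :: "'a measure \<Rightarrow> nat \<Rightarrow> ('a \<Rightarrow> complex mat) \<Rightarrow> bool" where
  "haar_unitary_rv M n U \<longleftrightarrow>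
     U \<in> measurable M (unitary_borel n) \<and>
     haar_unitary_measure n (distr M (unitary_borel n) U)"


section \<open>Noncommutative polynomials\<close>

(* A noncommutative polynomial maps each word in the indeterminates to its coefficient.
   The empty word carries the constant term. *)
type_synonym 'x nc_poly = "'x list \<Rightarrow>\<^sub>0 complex"

definition nc_poly_over :: "'x set \<Rightarrow> 'x nc_poly \<Rightarrow> bool" where
  "nc_poly_over V P \<longleftrightarrow> (\<forall>w\<in>Poly_Mapping.keys P. set w \<subseteq> V)"

definition nc_word_eval :: "nat \<Rightarrow> ('x \<Rightarrow> complex mat) \<Rightarrow> 'x list \<Rightarrow> complex mat" where
  "nc_word_eval n X w = foldr (\<lambda>x Y. X x * Y) w (1\<^sub>m n)"

definition nc_eval :: "nat \<Rightarrow> ('x \<Rightarrow> complex mat) \<Rightarrow> 'x nc_poly \<Rightarrow> complex mat" where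
  "nc_eval n X P = Matrix.mat n n (\<lambda>ij.
     \<Sum>w\<in>Poly_Mapping.keys P. Poly_Mapping.lookup P w * nc_word_eval n X w $$ ij)"


section \<open>The model\<close>

(* Eigenvalues with algebraic multiplicity. *)
definition eigenvalue_mset :: "complex mat \<Rightarrow> complex multiset" where
  "eigenvalue_mset A = proots (char_poly A)"

definition upper_left :: "nat \<Rightarrow> complex mat \<Rightarrow> complex mat" where
  "upper_left m A = Matrix.mat m m (\<lambda>ij. A $$ ij)"

definition pad :: "nat \<Rightarrow> nat \<Rightarrow> complex mat \<Rightarrow> complex mat" where
  "pad r N A = four_block_mat A (0\<^sub>m r (N - r)) (0\<^sub>m (N - r) r) (0\<^sub>m (N - r) (N - r))"

(* The indeterminate Inl i is replaced by A_i U*, the indeterminate Inr j by U B_j. *)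
definition model_mat ::
  "nat \<Rightarrow> (nat \<Rightarrow> complex mat) \<Rightarrow> (nat \<Rightarrow> complex mat) \<Rightarrow> (nat + nat) nc_poly
     \<Rightarrow> nat \<Rightarrow> complex mat \<Rightarrow> complex mat" where
  "model_mat r A B P N U =
     nc_eval N (case_sum (\<lambda>i. pad r N (A i) * mat_adjoint U) (\<lambda>j. U * pad r N (B j))) P"

(* The columns are e_1, ..., e_r, u_1, ..., u_r, e_(r+1), ..., e_(N-r). *)
definition basis_mat :: "nat \<Rightarrow> nat \<Rightarrow> complex mat \<Rightarrow> complex mat" where
  "basis_mat r N U = Matrix.mat_of_cols N
     (map (unit_vec N) [0..<r] @ map (Matrix.col U) [0..<r] @ map (unit_vec N) [r..<N - r])"

(* The matrix representing X in the basis formed by the columns of T;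
   meaningful only when T is invertible. *)
definition representing_mat :: "complex mat \<Rightarrow> complex mat \<Rightarrow> complex mat" where
  "representing_mat T X = the (mat_inverse T) * X * T"

definition nontrivial_block ::
  "nat \<Rightarrow> (nat \<Rightarrow> complex mat) \<Rightarrow> (nat \<Rightarrow> complex mat) \<Rightarrow> (nat + nat) nc_poly
     \<Rightarrow> nat \<Rightarrow> complex mat \<Rightarrow> complex mat" where
  "nontrivial_block r A B P N U =
     upper_left (2 * r) (representing_mat (basis_mat r N U) (model_mat r A B P N U))"

definition nontrivial_eigenvalues ::
  "nat \<Rightarrow> (nat \<Rightarrow> complex mat) \<Rightarrow> (nat \<Rightarrow> complex mat) \<Rightarrow> (nat + nat) nc_poly
     \<Rightarrow> nat \<Rightarrow> complex mat \<Rightarrow> complex multiset" where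
  "nontrivial_eigenvalues r A B P N U = eigenvalue_mset (nontrivial_block r A B P N U)"

(* P(a_1, ..., a_k, b_1, ..., b_l), as a function of the r x r truncation W of U. *)
definition block_formula ::
  "nat \<Rightarrow> (nat \<Rightarrow> complex mat) \<Rightarrow> (nat \<Rightarrow> complex mat) \<Rightarrow> (nat + nat) nc_poly
     \<Rightarrow> complex mat \<Rightarrow> complex mat" where
  "block_formula r A B P W = nc_eval (2 * r)
     (case_sum
       (\<lambda>i. four_block_mat (A i * mat_adjoint W) (A i) (0\<^sub>m r r) (0\<^sub>m r r))
       (\<lambda>j. four_block_mat (0\<^sub>m r r) (0\<^sub>m r r) (B j) (B j * W))) P"

(* The part of the block not containing W and its adjoint. *)
definition deterministic_part ::
  "nat \<Rightarrow> (nat \<Rightarrow> complex mat) \<Rightarrow> (nat \<Rightarrow> complex mat) \<Rightarrow> (nat + nat) nc_poly \<Rightarrow> complex mat" where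
  "deterministic_part r A B P = block_formula r A B P (0\<^sub>m r r)"

end

theory Submission
  imports Defs
begin

text \<open>
  Write \<open>T\<close> for the \<open>N \<times> 2r\<close> matrix with columns \<open>e\<^sub>1, \<dots>, e\<^sub>r, u\<^sub>1, \<dots>, u\<^sub>r\<close>. Both \<open>A\<^sub>i U\<^sup>*\<close> and
  \<open>U B\<^sub>j\<close> have the form \<open>T C\<close>, and \<open>C T\<close> is then the small matrix \<open>a\<^sub>i\<close> or \<open>b\<^sub>j\<close>. As \<open>P\<close> has no
  constant term, \<open>P(A\<^sub>1 U\<^sup>*, \<dots>, U B\<^sub>l) = T D\<close> with \<open>D T = P(a\<^sub>1, \<dots>, b\<^sub>l)\<close>
  (\<open>model_factorization\<close>). Since \<open>T D\<close> and \<open>D T\<close> have the same eigenvalues up to zeros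
  (\<open>eigenvalue_mset_mult_commute\<close>), the spectrum of the model consists of that of the block formula and
  \<open>N - 2r\<close> zeros, for every unitary \<open>U\<close>. Genericity of \<open>U\<close> matters only for reading the block
  formula as a block of a representing matrix, that is, for the invertibility of \<open>basis_mat\<close>.

  That invertibility amounts to the lower left \<open>r \<times> r\<close> minor of \<open>U\<close> being nonzero. Let \<open>G\<close> be a
  transposition matrix and \<open>V(z) = (1 + z)/2 + (1 - z)/2 G\<close>, which is unitary for \<open>z\<close> on the unit
  circle. A minor of \<open>V(z) W\<close> is a polynomial in \<open>z\<close> and, unless it is zero, vanishes for only
  finitely many \<open>z\<close>; as \<open>V(z) U\<close> and \<open>U\<close> are equally distributed, almost surely a minor of \<open>U\<close>
  can vanish only if the minor with the rows transposed by \<open>G\<close> vanishes too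
  (\<open>AE_row_minor_involution\<close>). Running through all choices of rows, almost surely either no minor of
  the first \<open>r\<close> columns vanishes or all do, and the second case contradicts the independence of the columns
  (\<open>AE_row_minor_nonzero\<close>).

  For the limits, the same family at \<open>z = \<i>\<close> compares the fourth moment of an entry with mixed
  moments and gives \<open>E \<bar>u\<^sub>i\<^sub>j\<bar>\<^sup>4 \<le> 6 / N\<^sup>2\<close> (\<open>fourth_moment_bound\<close>). These bounds are summable, so almost
  surely each entry of the truncation tends to zero (\<open>AE_haar_entry_tendsto_0\<close>), whatever the joint law
  of the matrices for different \<open>N\<close>. Then the block formula converges to its value at the zero
  truncation, its characteristic polynomial converges coefficientwise, and the roots can be labelled
  so that they converge (\<open>convergent_eigenvalue_labelling\<close>).
\<close>

section \<open>Factored matrices and their spectra\<close>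

lemma char_poly_block_lower_triangular:
  fixes B C D :: "complex mat"
  assumes B: "B \<in> carrier_mat n n" and C: "C \<in> carrier_mat m n" and D: "D \<in> carrier_mat m m"
  shows "char_poly (four_block_mat B (0\<^sub>m n m) C D) = char_poly B * char_poly D"
  using char_poly_0_block'[OF refl _ _ B C D] char_poly_factorized[OF B] char_poly_factorized[OF D]
  by blast

lemma char_poly_zero_mat: "char_poly (0\<^sub>m n n :: complex mat) = monom 1 n"
proof -
  have "upper_triangular (0\<^sub>m n n :: complex mat)" by (auto simp: upper_triangular_def)
  then have "char_poly (0\<^sub>m n n :: complex mat) = (\<Prod>a\<leftarrow>diag_mat (0\<^sub>m n n). [:- a, 1:])"
    by (intro char_poly_upper_triangular[of _ n]) auto
  also have "diag_mat (0\<^sub>m n n :: complex mat) = replicate n 0"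
    by (auto simp: diag_mat_def map_replicate_const intro!: nth_equalityI)
  finally show ?thesis by (simp add: monom_altdef)
qed

text \<open>
  Sylvester's identity. The block matrices with rows \<open>(T C, 0), (C, 0)\<close> and
  \<open>(0, 0), (C, C T)\<close> are conjugate by the unipotent matrix with rows \<open>(1, T), (0, 1)\<close>, and the
  two sides are their characteristic polynomials.
\<close>

lemma char_poly_mult_commute:
  fixes T C :: "complex mat"
  assumes T: "T \<in> carrier_mat n m" and C: "C \<in> carrier_mat m n"
  shows "char_poly (T * C) * monom 1 m = monom 1 n * char_poly (C * T)"
proof -
  let ?X = "four_block_mat (T * C) (0\<^sub>m n m) C (0\<^sub>m m m)"
  let ?Y = "four_block_mat (0\<^sub>m n n) (0\<^sub>m n m) C (C * T)"
  let ?P = "four_block_mat (1\<^sub>m n) T (0\<^sub>m m n) (1\<^sub>m m)"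
  let ?Q = "four_block_mat (1\<^sub>m n) (- T) (0\<^sub>m m n) (1\<^sub>m m)"
  have TC: "T * C \<in> carrier_mat n n" and CT: "C * T \<in> carrier_mat m m" using T C by auto
  have PQ: "?P * ?Q = 1\<^sub>m (n + m)"
    by (subst mult_four_block_mat) (use T in \<open>auto intro!: eq_matI simp: four_block_one_mat\<close>)
  have QP: "?Q * ?P = 1\<^sub>m (n + m)"
    by (subst mult_four_block_mat) (use T in \<open>auto intro!: eq_matI simp: four_block_one_mat\<close>)
  have XP: "?X * ?P = four_block_mat (T * C) (T * C * T) C (C * T)"
    by (subst mult_four_block_mat) (use T C TC CT in \<open>auto\<close>)
  have PY: "?P * ?Y = four_block_mat (T * C) (T * (C * T)) C (C * T)"
    by (subst mult_four_block_mat) (use T C TC CT in \<open>auto\<close>)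
  have cX: "?X \<in> carrier_mat (n + m) (n + m)" and cP: "?P \<in> carrier_mat (n + m) (n + m)"
    and cQ: "?Q \<in> carrier_mat (n + m) (n + m)" and cY: "?Y \<in> carrier_mat (n + m) (n + m)"
    using T C TC CT by auto
  have "?X * ?P = ?P * ?Y" unfolding XP PY using T C by (simp add: assoc_mult_mat[OF T C T])
  then have "?X * ?P * ?Q = ?P * ?Y * ?Q" by simp
  then have X: "?X = ?P * ?Y * ?Q"
    using assoc_mult_mat[OF cX cP cQ] PQ right_mult_one_mat[OF cX] by simp
  have "similar_mat ?X ?Y"
    unfolding similar_mat_def using similar_mat_witI[OF PQ QP X cX cY cP cQ] by blast
  then have "char_poly ?X = char_poly ?Y" by (rule char_poly_similar)
  then show ?thesis
    using char_poly_block_lower_triangular[OF TC C zero_carrier_mat]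
      char_poly_block_lower_triangular[OF zero_carrier_mat C CT]
    by (simp add: char_poly_zero_mat)
qed

lemma char_poly_nonzero: "(A :: complex mat) \<in> carrier_mat n n \<Longrightarrow> char_poly A \<noteq> 0"
  using degree_monic_char_poly[of A n] by auto

lemma proots_monom: "proots (monom (1::complex) n) = replicate_mset n 0"
  by (simp add: monom_altdef proots_power)

text \<open>
  This is the source of the trivial eigenvalues: a matrix of size \<open>n\<close> that factors through
  dimension \<open>m\<close> shares its spectrum with the small product, up to \<open>n - m\<close> zeros.
\<close>

lemma eigenvalue_mset_mult_commute:
  fixes T C :: "complex mat"
  assumes T: "T \<in> carrier_mat n m" and C: "C \<in> carrier_mat m n" and "m \<le> n"
  shows "eigenvalue_mset (T * C) = eigenvalue_mset (C * T) + replicate_mset (n - m) 0"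
proof -
  have TC: "T * C \<in> carrier_mat n n" and CT: "C * T \<in> carrier_mat m m" using T C by auto
  have "proots (char_poly (T * C) * monom 1 m) = proots (monom 1 n * char_poly (C * T))"
    using char_poly_mult_commute[OF T C] by simp
  then have "proots (char_poly (T * C)) + replicate_mset m 0
      = replicate_mset n 0 + proots (char_poly (C * T))"
    using char_poly_nonzero[OF TC] char_poly_nonzero[OF CT]
    by (simp add: proots_mult proots_monom monom_eq_0_iff)
  also have "replicate_mset n 0 = replicate_mset (n - m) 0 + replicate_mset m (0::complex)"
    using \<open>m \<le> n\<close> by (intro multiset_eqI) auto
  finally show ?thesis by (simp add: eigenvalue_mset_def)
qed

lemma nc_word_eval_simps [simp]:
  "nc_word_eval n X [] = 1\<^sub>m n"
  "nc_word_eval n X (v # w) = X v * nc_word_eval n X w"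
  by (simp_all add: nc_word_eval_def)

lemma nc_word_eval_carrier:
  "(\<And>v. v \<in> set w \<Longrightarrow> X v \<in> carrier_mat n n) \<Longrightarrow> nc_word_eval n X w \<in> carrier_mat n n"
  by (induction w) (auto intro!: mult_carrier_mat)

lemma nc_word_eval_intertwine:
  assumes "T \<in> carrier_mat n m"
    and "\<And>v. v \<in> set w \<Longrightarrow> X v \<in> carrier_mat n n"
    and "\<And>v. v \<in> set w \<Longrightarrow> x v \<in> carrier_mat m m"
    and "\<And>v. v \<in> set w \<Longrightarrow> X v * T = T * x v"
  shows "nc_word_eval n X w * T = T * nc_word_eval m x w"
  using assms(2-4)
proof (induction w)
  case Nil
  then show ?case using assms(1) by simp
next
  case (Cons v w)
  have c: "nc_word_eval n X w \<in> carrier_mat n n" "nc_word_eval m x w \<in> carrier_mat m m"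
    "X v \<in> carrier_mat n n" "x v \<in> carrier_mat m m"
    using Cons.prems by (auto intro!: nc_word_eval_carrier)
  have "X v * nc_word_eval n X w * T = X v * (T * nc_word_eval m x w)"
    using assoc_mult_mat[OF c(3,1) assms(1)] Cons by auto
  also have "\<dots> = T * x v * nc_word_eval m x w"
    using assoc_mult_mat[OF c(3) assms(1) c(2)] Cons.prems by simp
  also have "\<dots> = T * (x v * nc_word_eval m x w)"
    by (rule assoc_mult_mat[OF assms(1) c(4,2)])
  finally show ?case by simp
qed

lemma sum_mult_index:
  fixes c :: "'w \<Rightarrow> complex"
  assumes "T \<in> carrier_mat n m" "\<And>w. w \<in> S \<Longrightarrow> D w \<in> carrier_mat m p" "i < n" "j < p"
  shows "(\<Sum>w\<in>S. c w * (T * D w) $$ (i,j)) =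
    (T * Matrix.mat m p (\<lambda>ij. \<Sum>w\<in>S. c w * D w $$ ij)) $$ (i,j)"
proof -
  have "(\<Sum>w\<in>S. c w * (T * D w) $$ (i,j)) = (\<Sum>w\<in>S. \<Sum>q<m. c w * (T $$ (i,q) * D w $$ (q,j)))"
  proof (intro sum.cong refl)
    fix w assume "w \<in> S"
    with assms have "D w \<in> carrier_mat m p" by auto
    then show "c w * (T * D w) $$ (i,j) = (\<Sum>q<m. c w * (T $$ (i,q) * D w $$ (q,j)))"
      using assms by (auto simp: scalar_prod_def sum_distrib_left atLeast0LessThan)
  qed
  also have "\<dots> = (\<Sum>q<m. T $$ (i,q) * (\<Sum>w\<in>S. c w * D w $$ (q,j)))"
    by (subst sum.swap) (simp add: sum_distrib_left algebra_simps)
  also have "\<dots> = (T * Matrix.mat m p (\<lambda>ij. \<Sum>w\<in>S. c w * D w $$ ij)) $$ (i,j)"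
    using assms by (auto simp: scalar_prod_def atLeast0LessThan)
  finally show ?thesis .
qed

lemma mult_sum_index:
  fixes c :: "'w \<Rightarrow> complex"
  assumes "T \<in> carrier_mat m p" "\<And>w. w \<in> S \<Longrightarrow> D w \<in> carrier_mat n m" "i < n" "j < p"
  shows "(\<Sum>w\<in>S. c w * (D w * T) $$ (i,j)) =
    (Matrix.mat n m (\<lambda>ij. \<Sum>w\<in>S. c w * D w $$ ij) * T) $$ (i,j)"
proof -
  have "(\<Sum>w\<in>S. c w * (D w * T) $$ (i,j)) = (\<Sum>w\<in>S. \<Sum>q<m. c w * (D w $$ (i,q) * T $$ (q,j)))"
  proof (intro sum.cong refl)
    fix w assume "w \<in> S"
    with assms have "D w \<in> carrier_mat n m" by auto
    then show "c w * (D w * T) $$ (i,j) = (\<Sum>q<m. c w * (D w $$ (i,q) * T $$ (q,j)))"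
      using assms by (auto simp: scalar_prod_def sum_distrib_left atLeast0LessThan)
  qed
  also have "\<dots> = (\<Sum>q<m. (\<Sum>w\<in>S. c w * D w $$ (i,q)) * T $$ (q,j))"
    by (subst sum.swap) (simp add: sum_distrib_right mult.assoc)
  also have "\<dots> = (Matrix.mat n m (\<lambda>ij. \<Sum>w\<in>S. c w * D w $$ ij) * T) $$ (i,j)"
    using assms by (auto simp: scalar_prod_def atLeast0LessThan)
  finally show ?thesis .
qed

text \<open>
  A nonempty word in matrices with left factor \<open>T\<close> inherits the left factor of its first letter. Moving \<open>T\<close> through the remaining
  letters to the right turns each \<open>T * C v\<close> into \<open>C v * T\<close>, which evaluates the
  same word in the small matrices. The absence of a constant term excludes the empty word, whose
  value is the identity.
\<close>

lemma nc_eval_factorization: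
  assumes T: "T \<in> carrier_mat n m"
    and P: "nc_poly_over V P" "Poly_Mapping.lookup P [] = 0"
    and C: "\<And>v. v \<in> V \<Longrightarrow> C v \<in> carrier_mat m n"
    and X: "\<And>v. v \<in> V \<Longrightarrow> X v = T * C v" and x: "\<And>v. v \<in> V \<Longrightarrow> x v = C v * T"
  obtains D where "D \<in> carrier_mat m n" "nc_eval n X P = T * D" "nc_eval m x P = D * T"
proof -
  define G where "G = (\<lambda>w. C (hd w) * nc_word_eval n X (tl w))"
  define c where "c = Poly_Mapping.lookup P"
  let ?K = "Poly_Mapping.keys P"
  have G: "G w \<in> carrier_mat m n" "nc_word_eval n X w = T * G w" "nc_word_eval m x w = G w * T"
    if w: "w \<in> ?K" for w
  proof -
    have "w \<noteq> []" using w P(2) by (auto simp: in_keys_iff)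
    then obtain v u where vu: "w = v # u" by (cases w) auto
    have V: "v \<in> V" "set u \<subseteq> V" using P(1) w vu by (force simp: nc_poly_over_def)+
    have Xc: "X a \<in> carrier_mat n n" if "a \<in> V" for a
      unfolding X[OF that] by (rule mult_carrier_mat[OF T C[OF that]])
    have xc: "x a \<in> carrier_mat m m" if "a \<in> V" for a
      unfolding x[OF that] by (rule mult_carrier_mat[OF C[OF that] T])
    have Xu: "nc_word_eval n X u \<in> carrier_mat n n" and xu: "nc_word_eval m x u \<in> carrier_mat m m"
      using V Xc xc by (auto intro!: nc_word_eval_carrier)
    show "G w \<in> carrier_mat m n" using C[OF V(1)] Xu by (auto simp: G_def vu)
    show "nc_word_eval n X w = T * G w"
      using assoc_mult_mat[OF T C[OF V(1)] Xu] X[OF V(1)] by (simp add: G_def vu)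
    have "nc_word_eval n X u * T = T * nc_word_eval m x u"
      by (rule nc_word_eval_intertwine[OF T])
         (use V Xc xc X x C in \<open>auto simp: subset_iff assoc_mult_mat[OF T _ T]\<close>)
    then show "nc_word_eval m x w = G w * T"
      using assoc_mult_mat[OF C[OF V(1)] Xu T] assoc_mult_mat[OF C[OF V(1)] T xu] x[OF V(1)]
      by (simp add: G_def vu)
  qed
  let ?D = "Matrix.mat m n (\<lambda>ij. \<Sum>w\<in>?K. c w * G w $$ ij)"
  show thesis
  proof (rule that[of ?D])
    show "?D \<in> carrier_mat m n" by simp
    show "nc_eval n X P = T * ?D"
    proof (rule eq_matI)
      fix i j assume "i < dim_row (T * ?D)" "j < dim_col (T * ?D)"
      then have ij: "i < n" "j < n" using T by auto
      show "nc_eval n X P $$ (i,j) = (T * ?D) $$ (i,j)"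
        using sum_mult_index[OF T G(1) ij, where c = c and S = ?K] ij G(2)
        by (simp add: nc_eval_def c_def)
    qed (use T in \<open>auto simp: nc_eval_def\<close>)
    show "nc_eval m x P = ?D * T"
    proof (rule eq_matI)
      fix i j assume "i < dim_row (?D * T)" "j < dim_col (?D * T)"
      then have ij: "i < m" "j < m" using T by auto
      show "nc_eval m x P $$ (i,j) = (?D * T) $$ (i,j)"
        using mult_sum_index[OF T G(1) ij, where c = c and S = ?K] ij G(3)
        by (simp add: nc_eval_def c_def)
    qed (use T in \<open>auto simp: nc_eval_def\<close>)
  qed
qed

section \<open>The model in the span of the distinguished columns\<close>

lemma mat_adjoint_index:
  fixes V :: "complex mat"
  assumes "V \<in> carrier_mat n m" "i < m" "j < n"
  shows "mat_adjoint V $$ (i,j) = cnj (V $$ (j,i))"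
  using assms by (simp add: mat_adjoint_def mat_of_rows_index conjugate_complex_def)

lemma mat_adjoint_carrier [simp]:
  "V \<in> carrier_mat n m \<Longrightarrow> mat_adjoint V \<in> carrier_mat m n"
  unfolding mat_adjoint_def by (intro carrier_matI) auto

lemma mult_mat_index:
  assumes "X \<in> carrier_mat n m" "Y \<in> carrier_mat m p" "i < n" "j < p"
  shows "(X * Y) $$ (i,j) = (\<Sum>q<m. X $$ (i,q) * Y $$ (q,j))"
  using assms by (auto simp: scalar_prod_def atLeast0LessThan)

lemma mult_delta:
  "x * (if P then 1 else 0) = (if P then x else 0)" "(if P then 1 else 0) * x = (if P then x else 0)"
  for x :: complex
  by simp_all

lemma unitary_columns_orthonormal:
  assumes "V \<in> unitary_group n" "i < n" "j < n"
  shows "(\<Sum>s<n. cnj (V $$ (s,i)) * V $$ (s,j)) = (if i = j then 1 else 0)"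
proof -
  have V: "V \<in> carrier_mat n n" "mat_adjoint V * V = 1\<^sub>m n"
    using assms(1) by (auto simp: unitary_group_def)
  have "(mat_adjoint V * V) $$ (i,j) = (\<Sum>s<n. cnj (V $$ (s,i)) * V $$ (s,j))"
    using assms(2,3)
    by (simp add: mult_mat_index[OF mat_adjoint_carrier[OF V(1)] V(1)] mat_adjoint_index[OF V(1)])
  then show ?thesis using V(2) assms by simp
qed

text \<open>
  The columns \<open>e\<^sub>1, \<dots>, e\<^sub>r, u\<^sub>1, \<dots>, u\<^sub>r\<close>, whose span contains the range of every
  nonconstant word in the model.
\<close>

definition span_mat :: "nat \<Rightarrow> nat \<Rightarrow> complex mat \<Rightarrow> complex mat" where
  "span_mat r N U = Matrix.mat N (2 * r)
     (\<lambda>(s,j). if j < r then (if s = j then 1 else 0) else U $$ (s, j - r))"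

text \<open>
  The rows of coordinates for which \<open>A\<^sub>i U\<^sup>*\<close> and \<open>U B\<^sub>j\<close> are \<open>span_mat\<close> times
  \<open>coordinate_mat\<close>: the range of \<open>A\<^sub>i U\<^sup>*\<close> uses only \<open>e\<^sub>1, \<dots>, e\<^sub>r\<close>, that of
  \<open>U B\<^sub>j\<close> only \<open>u\<^sub>1, \<dots>, u\<^sub>r\<close>.
\<close>

definition coordinate_mat ::
  "nat \<Rightarrow> (nat \<Rightarrow> complex mat) \<Rightarrow> (nat \<Rightarrow> complex mat) \<Rightarrow> nat \<Rightarrow> complex mat \<Rightarrow> nat + nat \<Rightarrow> complex mat"
  where
  "coordinate_mat r A B N U = case_sum
     (\<lambda>i. Matrix.mat (2 * r) N (\<lambda>(a,t). if a < r then (\<Sum>q<r. A i $$ (a,q) * cnj (U $$ (t,q))) else 0))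
     (\<lambda>j. Matrix.mat (2 * r) N (\<lambda>(a,t). if a < r \<or> r \<le> t then 0 else B j $$ (a - r, t)))"

lemma span_mat_carrier [simp]: "span_mat r N U \<in> carrier_mat N (2 * r)"
  by (simp add: span_mat_def)

lemma coordinate_mat_carrier [simp]: "coordinate_mat r A B N U v \<in> carrier_mat (2 * r) N"
  by (cases v) (simp_all add: coordinate_mat_def)

lemma sum_split_double: "(\<Sum>q<2 * r. f q) = (\<Sum>q<r. f q) + (\<Sum>q<r. f (r + q))"
  for f :: "nat \<Rightarrow> complex"
proof -
  have "(\<Sum>q<2 * r. f q) = sum f {0..<r} + sum f {r..<2*r}"
    by (simp add: sum.atLeastLessThan_concat lessThan_atLeast0)
  also have "sum f {r..<2*r} = (\<Sum>q<r. f (r + q))"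
    using sum.shift_bounds_nat_ivl[of f 0 r r] by (simp add: lessThan_atLeast0 add.commute mult_2)
  finally show ?thesis by (simp add: lessThan_atLeast0)
qed

lemma sum_restrict_lessThan:
  assumes "r \<le> (n::nat)"
  shows "(\<Sum>q<n. if q < r then f q else 0) = (\<Sum>q<r. f q)"
  using assms by (intro sum.mono_neutral_cong_right) auto

lemma pad_carrier: "X \<in> carrier_mat r r \<Longrightarrow> r \<le> N \<Longrightarrow> pad r N X \<in> carrier_mat N N"
  by (auto simp: pad_def)

lemma pad_index:
  "X \<in> carrier_mat r r \<Longrightarrow> r \<le> N \<Longrightarrow> s < N \<Longrightarrow> q < N \<Longrightarrow>
     pad r N X $$ (s,q) = (if s < r \<and> q < r then X $$ (s,q) else 0)"
  by (auto simp: pad_def)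

lemma span_mult_coordinate:
  assumes U: "U \<in> carrier_mat N N" and N: "2 * r \<le> N"
  shows "A i \<in> carrier_mat r r \<Longrightarrow>
      pad r N (A i) * mat_adjoint U = span_mat r N U * coordinate_mat r A B N U (Inl i)"
    and "B j \<in> carrier_mat r r \<Longrightarrow>
      U * pad r N (B j) = span_mat r N U * coordinate_mat r A B N U (Inr j)"
proof -
  assume A: "A i \<in> carrier_mat r r"
  note c = pad_carrier[OF A, of N] mat_adjoint_carrier[OF U]
  show "pad r N (A i) * mat_adjoint U = span_mat r N U * coordinate_mat r A B N U (Inl i)"
  proof (rule eq_matI)
    fix s t assume "s < dim_row (span_mat r N U * coordinate_mat r A B N U (Inl i))"
      "t < dim_col (span_mat r N U * coordinate_mat r A B N U (Inl i))"
    then have st: "s < N" "t < N" by (auto simp: span_mat_def coordinate_mat_def)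
    have "(pad r N (A i) * mat_adjoint U) $$ (s,t)
        = (\<Sum>q<N. if q < r then (if s < r then A i $$ (s,q) * cnj (U $$ (t,q)) else 0) else 0)"
      using c N st by (subst mult_mat_index[where m = N])
        (auto simp: pad_index[OF A] mat_adjoint_index[OF U] intro!: sum.cong)
    also have "\<dots> = (\<Sum>q<r. if s < r then A i $$ (s,q) * cnj (U $$ (t,q)) else 0)"
      using N by (intro sum_restrict_lessThan) simp
    also have "\<dots> = (span_mat r N U * coordinate_mat r A B N U (Inl i)) $$ (s,t)"
      using N st by (subst mult_mat_index[OF span_mat_carrier coordinate_mat_carrier])
        (auto simp: sum_split_double span_mat_def coordinate_mat_def mult_delta)
    finally show "(pad r N (A i) * mat_adjoint U) $$ (s,t)
      = (span_mat r N U * coordinate_mat r A B N U (Inl i)) $$ (s,t)" .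
  qed (use c N in \<open>auto simp: span_mat_def coordinate_mat_def\<close>)
next
  assume B: "B j \<in> carrier_mat r r"
  note c = pad_carrier[OF B, of N]
  show "U * pad r N (B j) = span_mat r N U * coordinate_mat r A B N U (Inr j)"
  proof (rule eq_matI)
    fix s t assume "s < dim_row (span_mat r N U * coordinate_mat r A B N U (Inr j))"
      "t < dim_col (span_mat r N U * coordinate_mat r A B N U (Inr j))"
    then have st: "s < N" "t < N" by (auto simp: span_mat_def coordinate_mat_def)
    have "(U * pad r N (B j)) $$ (s,t)
        = (\<Sum>q<N. if q < r then (if t < r then U $$ (s,q) * B j $$ (q,t) else 0) else 0)"
      using c N st U by (subst mult_mat_index[where m = N])
        (auto simp: pad_index[OF B] intro!: sum.cong)
    also have "\<dots> = (\<Sum>q<r. if t < r then U $$ (s,q) * B j $$ (q,t) else 0)"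
      using N by (intro sum_restrict_lessThan) simp
    also have "\<dots> = (span_mat r N U * coordinate_mat r A B N U (Inr j)) $$ (s,t)"
      using N st by (subst mult_mat_index[OF span_mat_carrier coordinate_mat_carrier])
        (auto simp: sum_split_double span_mat_def coordinate_mat_def intro!: sum.cong)
    finally show "(U * pad r N (B j)) $$ (s,t)
      = (span_mat r N U * coordinate_mat r A B N U (Inr j)) $$ (s,t)" .
  qed (use U c N in \<open>auto simp: span_mat_def coordinate_mat_def\<close>)
qed

text \<open>
  The off-diagonal blocks \<open>A\<^sub>i\<close> and \<open>B\<^sub>j\<close> do not contain \<open>U\<close> because of unitarity: in the first
  one, the inner products of the columns of \<open>U\<close> appear, and these are Kronecker deltas. The
  truncation of \<open>U\<close> comes from the inner products between the \<open>e\<^sub>a\<close> and the \<open>u\<^sub>b\<close>.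
\<close>

lemma coordinate_mult_span:
  assumes U: "U \<in> unitary_group N" and N: "2 * r \<le> N"
  shows "A i \<in> carrier_mat r r \<Longrightarrow> coordinate_mat r A B N U (Inl i) * span_mat r N U =
      four_block_mat (A i * mat_adjoint (upper_left r U)) (A i) (0\<^sub>m r r) (0\<^sub>m r r)"
    and "B j \<in> carrier_mat r r \<Longrightarrow> coordinate_mat r A B N U (Inr j) * span_mat r N U =
      four_block_mat (0\<^sub>m r r) (0\<^sub>m r r) (B j) (B j * upper_left r U)"
proof -
  have W: "upper_left r U \<in> carrier_mat r r" by (simp add: upper_left_def)
  note W' = mat_adjoint_carrier[OF W]
  {
    assume A: "A i \<in> carrier_mat r r"
    show "coordinate_mat r A B N U (Inl i) * span_mat r N U =
      four_block_mat (A i * mat_adjoint (upper_left r U)) (A i) (0\<^sub>m r r) (0\<^sub>m r r)" (is "_ = ?R")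
    proof (rule eq_matI)
      fix a b assume "a < dim_row ?R" "b < dim_col ?R"
      then have ab: "a < 2 * r" "b < 2 * r" using A W' by auto
      have L: "(coordinate_mat r A B N U (Inl i) * span_mat r N U) $$ (a,b) =
          (\<Sum>s<N. (if a < r then (\<Sum>q<r. A i $$ (a,q) * cnj (U $$ (s,q))) else 0) *
             (if b < r then (if s = b then 1 else 0) else U $$ (s, b - r)))"
        using ab by (subst mult_mat_index[OF coordinate_mat_carrier span_mat_carrier])
          (auto simp: coordinate_mat_def span_mat_def intro!: sum.cong)
      show "(coordinate_mat r A B N U (Inl i) * span_mat r N U) $$ (a,b) = ?R $$ (a,b)"
      proof (cases "a < r")
        case False
        then show ?thesis unfolding L using ab A W' by simp
      next
        case a: True
        show ?thesis
        proof (cases "b < r")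
          case b: True
          have "(coordinate_mat r A B N U (Inl i) * span_mat r N U) $$ (a,b)
              = (\<Sum>q<r. A i $$ (a,q) * cnj (U $$ (b,q)))"
            unfolding L using a b N by (simp add: mult_delta)
          also have "\<dots> = (A i * mat_adjoint (upper_left r U)) $$ (a,b)"
            using a b
            by (simp add: mult_mat_index[OF A W'] mat_adjoint_index[OF W]) (simp add: upper_left_def)
          finally show ?thesis using a b A W' by simp
        next
          case b: False
          have "(coordinate_mat r A B N U (Inl i) * span_mat r N U) $$ (a,b)
              = (\<Sum>q<r. A i $$ (a,q) * (\<Sum>s<N. cnj (U $$ (s,q)) * U $$ (s, b - r)))"
            unfolding L using a b
            by (simp add: sum_distrib_right sum_distrib_left mult.assoc) (rule sum.swap)
          also have "\<dots> = (\<Sum>q<r. A i $$ (a,q) * (if q = b - r then 1 else 0))"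
            using N ab b by (intro sum.cong refl) (simp add: unitary_columns_orthonormal[OF U])
          also have "\<dots> = A i $$ (a, b - r)"
            using ab b by (simp add: mult_delta)
          finally show ?thesis using a b ab A W' by simp
        qed
      qed
    qed (use A W' in \<open>auto simp: coordinate_mat_def span_mat_def\<close>)
  }
  {
    assume B: "B j \<in> carrier_mat r r"
    show "coordinate_mat r A B N U (Inr j) * span_mat r N U =
      four_block_mat (0\<^sub>m r r) (0\<^sub>m r r) (B j) (B j * upper_left r U)" (is "_ = ?R")
    proof (rule eq_matI)
      fix a b assume "a < dim_row ?R" "b < dim_col ?R"
      then have ab: "a < 2 * r" "b < 2 * r" using B W by auto
      have "(coordinate_mat r A B N U (Inr j) * span_mat r N U) $$ (a,b) =
          (\<Sum>s<N. if s < r then (if a < r then 0 else B j $$ (a - r, s)) *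
             (if b < r then (if s = b then 1 else 0) else U $$ (s, b - r)) else 0)"
        using ab by (subst mult_mat_index[OF coordinate_mat_carrier span_mat_carrier])
          (auto simp: coordinate_mat_def span_mat_def intro!: sum.cong)
      also have "\<dots> = (\<Sum>s<r. (if a < r then 0 else B j $$ (a - r, s)) *
             (if b < r then (if s = b then 1 else 0) else U $$ (s, b - r)))"
        using N by (intro sum_restrict_lessThan) simp
      finally have L: "(coordinate_mat r A B N U (Inr j) * span_mat r N U) $$ (a,b) = \<dots>" .
      show "(coordinate_mat r A B N U (Inr j) * span_mat r N U) $$ (a,b) = ?R $$ (a,b)"
      proof (cases "a < r")
        case True
        then show ?thesis unfolding L using ab B W by simp
      next
        case a: False
        show ?thesis
        proof (cases "b < r")
          case True
          then show ?thesis unfolding L using ab a B W by (simp add: mult_delta)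
        next
          case b: False
          have "(B j * upper_left r U) $$ (a - r, b - r) = (\<Sum>s<r. B j $$ (a - r, s) * U $$ (s, b - r))"
            using a b ab by (subst mult_mat_index[OF B W]) (auto simp: upper_left_def)
          then show ?thesis unfolding L using ab a b B W by simp
        qed
      qed
    qed (use B W in \<open>auto simp: coordinate_mat_def span_mat_def\<close>)
  }
qed

text \<open>
  Since only \<open>T * D\<close> and \<open>D * T\<close> enter, the spectrum of the model is known from the block formula
  for every unitary \<open>U\<close>, also where the vectors of \<open>basis_mat\<close> are linearly dependent.
\<close>

lemma model_factorization:
  assumes U: "U \<in> unitary_group N" and N: "2 * r \<le> N"
    and A: "\<And>i. i < k \<Longrightarrow> A i \<in> carrier_mat r r" and B: "\<And>j. j < l \<Longrightarrow> B j \<in> carrier_mat r r"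
    and P: "nc_poly_over ({..<k} <+> {..<l}) P" "Poly_Mapping.lookup P [] = 0"
  obtains D where "D \<in> carrier_mat (2 * r) N"
    "model_mat r A B P N U = span_mat r N U * D"
    "block_formula r A B P (upper_left r U) = D * span_mat r N U"
proof -
  have Uc: "U \<in> carrier_mat N N" using U by (simp add: unitary_group_def)
  show thesis
  proof (rule nc_eval_factorization[OF span_mat_carrier[of r N U] P coordinate_mat_carrier[of r A B N U]])
    fix v :: "nat + nat" assume v: "v \<in> {..<k} <+> {..<l}"
    show "case_sum (\<lambda>i. pad r N (A i) * mat_adjoint U) (\<lambda>j. U * pad r N (B j)) v
        = span_mat r N U * coordinate_mat r A B N U v"
      using v span_mult_coordinate[OF Uc N] A B by auto
    show "case_sum
       (\<lambda>i. four_block_mat (A i * mat_adjoint (upper_left r U)) (A i) (0\<^sub>m r r) (0\<^sub>m r r))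
       (\<lambda>j. four_block_mat (0\<^sub>m r r) (0\<^sub>m r r) (B j) (B j * upper_left r U)) v
        = coordinate_mat r A B N U v * span_mat r N U"
      using v coordinate_mult_span[OF U N] A B by auto
  qed (use that in \<open>auto simp: model_mat_def block_formula_def\<close>)
qed

lemma basis_mat_carrier: "2 * r \<le> N \<Longrightarrow> basis_mat r N U \<in> carrier_mat N N"
  by (simp add: basis_mat_def mat_of_cols_def)

lemma basis_mat_index:
  assumes "U \<in> carrier_mat N N" "2 * r \<le> N" "i < N" "j < N"
  shows "basis_mat r N U $$ (i,j) =
    (if j < r then (if i = j then 1 else 0) else if j < 2 * r then U $$ (i, j - r)
     else if i = j - r then 1 else 0)"
  using assms by (auto simp: basis_mat_def mat_of_cols_index nth_append)

lemma mat_inverse_of_det_nonzero: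
  fixes Q :: "complex mat"
  assumes Q: "Q \<in> carrier_mat n n" and "Determinant.det Q \<noteq> 0"
  obtains R where "mat_inverse Q = Some R" "R \<in> carrier_mat n n" "R * Q = 1\<^sub>m n" "Q * R = 1\<^sub>m n"
proof (cases "mat_inverse Q")
  case None
  then show ?thesis
    using mat_inverse(1)[OF Q None, of undefined] det_non_zero_imp_unit[OF Q assms(2), of undefined]
    by blast
next
  case (Some R)
  then show ?thesis using that mat_inverse(2)[OF Q Some] by blast
qed

text \<open>
  Write \<open>Q\<close> for the basis, \<open>J\<close> for the inclusion of the first \<open>2 r\<close> coordinates and \<open>T = Q J\<close>. From
  \<open>X = T D\<close> follows \<open>X Q J = T (D T) = Q J (D T)\<close>, hence \<open>(Q\<^sup>-\<^sup>1 X Q) J = J (D T)\<close>: the first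
  \<open>2 r\<close> columns of the representing matrix are \<open>D T\<close> above zeros.
\<close>

lemma nontrivial_block_eq:
  assumes U: "U \<in> unitary_group N" and N: "2 * r \<le> N"
    and D: "D \<in> carrier_mat (2 * r) N" "model_mat r A B P N U = span_mat r N U * D"
    and inv: "invertible_mat (basis_mat r N U)"
  shows "nontrivial_block r A B P N U = D * span_mat r N U"
proof -
  let ?Q = "basis_mat r N U" and ?T = "span_mat r N U"
  define J where "J = Matrix.mat N (2 * r) (\<lambda>(i,j). if i = j then 1 else (0::complex))"
  have Uc: "U \<in> carrier_mat N N" using U by (simp add: unitary_group_def)
  note Q = basis_mat_carrier[OF N, of U]
  have J: "J \<in> carrier_mat N (2 * r)" by (simp add: J_def)
  have ZJ: "(Z * J) $$ (i,j) = Z $$ (i,j)" if "Z \<in> carrier_mat N N" "i < N" "j < 2 * r" for Z i j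
    using that N by (subst mult_mat_index[OF that(1) J])
      (auto simp: J_def mult_delta)
  have JK: "(J * K) $$ (i,j) = K $$ (i,j)"
    if "K \<in> carrier_mat (2 * r) (2 * r)" "i < 2 * r" "j < 2 * r" for K i j
    using that N by (subst mult_mat_index[OF J that(1)])
      (auto simp: J_def mult_delta)
  have QJ: "?Q * J = ?T"
  proof (rule eq_matI)
    fix i j assume "i < dim_row ?T" "j < dim_col ?T"
    then have ij: "i < N" "j < 2 * r" by (auto simp: span_mat_def)
    then show "(?Q * J) $$ (i,j) = ?T $$ (i,j)"
      using N by (simp add: ZJ[OF Q ij] basis_mat_index[OF Uc N] span_mat_def)
  qed (use Q J in \<open>auto simp: span_mat_def\<close>)
  have "Determinant.det ?Q \<noteq> 0"
  proof -
    obtain R where "inverts_mat ?Q R" "inverts_mat R ?Q" using inv by (auto simp: invertible_mat_def)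
    then have R: "?Q * R = 1\<^sub>m N" "R * ?Q = 1\<^sub>m (dim_row R)" using Q by (auto simp: inverts_mat_def)
    then have "R \<in> carrier_mat N N"
      by (metis Q carrier_matD(2) carrier_matI index_mult_mat(2,3) index_one_mat(2,3))
    then have "Determinant.det ?Q * Determinant.det R = 1" using R(1) det_mult[OF Q] by (metis det_one)
    then show ?thesis by auto
  qed
  then obtain R where R: "mat_inverse ?Q = Some R" "R \<in> carrier_mat N N" "R * ?Q = 1\<^sub>m N"
    using mat_inverse_of_det_nonzero[OF Q] by blast
  let ?X = "model_mat r A B P N U"
  let ?K = "D * ?T"
  have X: "?X \<in> carrier_mat N N" unfolding D(2) using D(1) by (rule mult_carrier_mat[OF span_mat_carrier])
  have K: "?K \<in> carrier_mat (2 * r) (2 * r)" using D(1) by (rule mult_carrier_mat[OF _ span_mat_carrier])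
  have RX: "R * ?X \<in> carrier_mat N N" using R X by auto
  then have RXQ: "R * ?X * ?Q \<in> carrier_mat N N" using Q by auto
  have "R * ?X * ?Q * J = R * ?X * ?T" using assoc_mult_mat[OF RX Q J] QJ by simp
  also have "\<dots> = R * (?X * ?T)" by (rule assoc_mult_mat[OF R(2) X span_mat_carrier])
  also have "?X * ?T = ?T * ?K"
    unfolding D(2) by (rule assoc_mult_mat[OF span_mat_carrier D(1) span_mat_carrier])
  also have "\<dots> = ?Q * (J * ?K)" using assoc_mult_mat[OF Q J K] QJ by simp
  also have "R * \<dots> = J * ?K"
    using assoc_mult_mat[OF R(2) Q mult_carrier_mat[OF J K]] R(3)
      left_mult_one_mat[OF mult_carrier_mat[OF J K]] by simp
  finally have key: "R * ?X * ?Q * J = J * ?K" .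
  have "upper_left (2 * r) (R * ?X * ?Q) = ?K"
  proof (rule eq_matI)
    fix i j assume "i < dim_row ?K" "j < dim_col ?K"
    then have ij: "i < 2 * r" "j < 2 * r" using K by auto
    then have "upper_left (2 * r) (R * ?X * ?Q) $$ (i,j) = (R * ?X * ?Q * J) $$ (i,j)"
      using N by (simp add: ZJ[OF RXQ] upper_left_def)
    then show "upper_left (2 * r) (R * ?X * ?Q) $$ (i,j) = ?K $$ (i,j)"
      unfolding key JK[OF K ij] .
  qed (use K in \<open>auto simp: upper_left_def\<close>)
  then show ?thesis by (simp add: nontrivial_block_def representing_mat_def R(1))
qed

text \<open>
  In a vanishing linear combination of the basis vectors, the last \<open>r\<close> coordinates involve only
  \<open>u\<^sub>1, \<dots>, u\<^sub>r\<close>. So the lower left minor of \<open>U\<close> decides the matter: if it is nonzero, the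
  coefficients of the \<open>u\<^sub>j\<close> vanish, and the others are then read off from the other coordinates.
\<close>

lemma basis_mat_invertible:
  assumes U: "U \<in> carrier_mat N N" and N: "2 * r \<le> N"
    and det: "Determinant.det (Matrix.mat r r (\<lambda>(i,j). U $$ (N - r + i, j))) \<noteq> 0"
  shows "invertible_mat (basis_mat r N U)"
proof -
  let ?Q = "basis_mat r N U"
  note Q = basis_mat_carrier[OF N, of U]
  have "Determinant.det ?Q \<noteq> 0"
  proof
    assume "Determinant.det ?Q = 0"
    then obtain v where v: "v \<in> carrier_vec N" "v \<noteq> 0\<^sub>v N" "?Q *\<^sub>v v = 0\<^sub>v N"
      using det_0_iff_vec_prod_zero_field[OF Q] by blast
    let ?v = "vec_index v"
    define w where "w = Matrix.vec r (\<lambda>j. ?v (r + j))"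
    have eq: "(if i < r then ?v i else 0) + (\<Sum>j<r. U $$ (i,j) * ?v (r + j))
        + (if r \<le> i \<and> i < N - r then ?v (r + i) else 0) = 0" if i: "i < N" for i
    proof -
      have "0 = vec_index (?Q *\<^sub>v v) i" using v(3) i by simp
      also have "\<dots> = (\<Sum>j<N. ?Q $$ (i,j) * ?v j)"
        using Q v(1) i by (auto simp: mult_mat_vec_def scalar_prod_def atLeast0LessThan)
      also have "\<dots> = (\<Sum>j\<in>{0..<2*r}. ?Q $$ (i,j) * ?v j) + (\<Sum>j\<in>{2*r..<N}. ?Q $$ (i,j) * ?v j)"
        using N by (simp add: sum.atLeastLessThan_concat lessThan_atLeast0)
      also have "(\<Sum>j\<in>{2*r..<N}. ?Q $$ (i,j) * ?v j) = (\<Sum>j\<in>{2*r..<N}. if j = r + i then ?v j else 0)"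
        using i N by (intro sum.cong) (auto simp: basis_mat_index[OF U N])
      also have "\<dots> = (if r \<le> i \<and> i < N - r then ?v (r + i) else 0)"
        using i N by (auto simp: sum.delta)
      also have "(\<Sum>j\<in>{0..<2*r}. ?Q $$ (i,j) * ?v j) = (\<Sum>j<r. ?Q $$ (i,j) * ?v j)
          + (\<Sum>j<r. ?Q $$ (i, r + j) * ?v (r + j))"
        by (simp add: sum_split_double flip: lessThan_atLeast0)
      also have "(\<Sum>j<r. ?Q $$ (i,j) * ?v j) = (\<Sum>j<r. if j = i then ?v j else 0)"
        using i N by (intro sum.cong) (auto simp: basis_mat_index[OF U N])
      also have "\<dots> = (if i < r then ?v i else 0)" by simp
      also have "(\<Sum>j<r. ?Q $$ (i, r + j) * ?v (r + j)) = (\<Sum>j<r. U $$ (i,j) * ?v (r + j))"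
        using i N by (intro sum.cong) (auto simp: basis_mat_index[OF U N])
      finally show ?thesis by simp
    qed
    have "Matrix.mat r r (\<lambda>(i,j). U $$ (N - r + i, j)) *\<^sub>v w = 0\<^sub>v r"
    proof (rule eq_vecI)
      fix i assume "i < dim_vec (0\<^sub>v r :: complex Matrix.vec)"
      then have i: "i < r" by simp
      have c: "\<not> N - r + i < r" "\<not> N - r + i < N - r" "N - r + i < N" using N i by auto
      then have "(\<Sum>j<r. U $$ (N - r + i, j) * ?v (r + j)) = 0"
        using eq[OF c(3)] c(1,2) by (simp only: if_False simp_thms add_0_left add_0_right)
      then show "vec_index (Matrix.mat r r (\<lambda>(i,j). U $$ (N - r + i, j)) *\<^sub>v w) i = vec_index (0\<^sub>v r) i"
        using i by (simp add: mult_mat_vec_def scalar_prod_def atLeast0LessThan w_def)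
    qed simp
    moreover have "w \<in> carrier_vec r" by (simp add: w_def)
    ultimately have "w = 0\<^sub>v r"
      using det det_0_iff_vec_prod_zero_field[OF mat_carrier[of r r "\<lambda>(i,j). U $$ (N - r + i, j)"]]
      by blast
    then have mid: "?v (r + j) = 0" if "j < r" for j
      using that by (metis index_vec index_zero_vec(1) w_def)
    have "?v i = 0" if i: "i < N" for i
    proof -
      consider "i < r" | "r \<le> i" "i < 2 * r" | "2 * r \<le> i" by linarith
      then show ?thesis
      proof cases
        case 1
        then show ?thesis using eq[of i] mid i N by simp
      next
        case 2
        then show ?thesis using mid[of "i - r"] by simp
      next
        case 3
        have "i - r < N" "r \<le> i - r" "i - r < N - r" "r + (i - r) = i" using 3 i by auto
        then show ?thesis using eq[of "i - r"] mid N by simp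
      qed
    qed
    then have "v = 0\<^sub>v N" using v(1) by (intro eq_vecI) auto
    with v(2) show False by simp
  qed
  then show ?thesis
    using mat_inverse_of_det_nonzero[OF Q] Q
    by (metis carrier_matD(1) invertible_mat_def inverts_mat_def square_mat.simps carrier_matD(2))
qed

section \<open>Haar measure and nonvanishing minors\<close>

lemma mat_adjoint_mult:
  fixes V W :: "complex mat"
  assumes V: "V \<in> carrier_mat n n" and W: "W \<in> carrier_mat n n"
  shows "mat_adjoint (V * W) = mat_adjoint W * mat_adjoint V"
proof (rule eq_matI)
  note c = mat_adjoint_carrier[OF V] mat_adjoint_carrier[OF W]
  fix i j assume "i < dim_row (mat_adjoint W * mat_adjoint V)" "j < dim_col (mat_adjoint W * mat_adjoint V)"
  then have ij: "i < n" "j < n" using c by auto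
  then show "mat_adjoint (V * W) $$ (i,j) = (mat_adjoint W * mat_adjoint V) $$ (i,j)"
    by (simp add: mat_adjoint_index[OF mult_carrier_mat[OF V W]] mult_mat_index[OF V W]
        mult_mat_index[OF c(2,1)] mat_adjoint_index[OF V] mat_adjoint_index[OF W] mult.commute
        del: index_mult_mat)
qed (use mat_adjoint_carrier[OF mult_carrier_mat[OF V W]] mat_adjoint_carrier[OF V]
       mat_adjoint_carrier[OF W] in auto)

lemma unitary_group_mult:
  assumes "V \<in> unitary_group n" "W \<in> unitary_group n"
  shows "V * W \<in> unitary_group n"
proof -
  let ?V = "mat_adjoint V" and ?W = "mat_adjoint W"
  have V: "V \<in> carrier_mat n n" "V * ?V = 1\<^sub>m n" "?V * V = 1\<^sub>m n"
    and W: "W \<in> carrier_mat n n" "W * ?W = 1\<^sub>m n" "?W * W = 1\<^sub>m n"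
    using assms by (auto simp: unitary_group_def)
  note c = mat_adjoint_carrier[OF V(1)] mat_adjoint_carrier[OF W(1)]
  have "V * W * (?W * ?V) = V * (W * (?W * ?V))"
    by (rule assoc_mult_mat[OF V(1) W(1) mult_carrier_mat[OF c(2,1)]])
  also have "W * (?W * ?V) = W * ?W * ?V"
    by (rule assoc_mult_mat[OF W(1) c(2,1), symmetric])
  also have "V * \<dots> = 1\<^sub>m n" using V W(2) left_mult_one_mat[OF c(1)] by simp
  finally have 1: "V * W * (?W * ?V) = 1\<^sub>m n" .
  have "?W * ?V * (V * W) = ?W * (?V * (V * W))"
    by (rule assoc_mult_mat[OF c(2,1) mult_carrier_mat[OF V(1) W(1)]])
  also have "?V * (V * W) = ?V * V * W"
    by (rule assoc_mult_mat[OF c(1) V(1) W(1), symmetric])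
  also have "?W * \<dots> = 1\<^sub>m n" using V(3) W left_mult_one_mat[OF W(1)] by simp
  finally have 2: "?W * ?V * (V * W) = 1\<^sub>m n" .
  show ?thesis using V(1) W(1) 1 2 by (simp add: unitary_group_def mat_adjoint_mult)
qed

text \<open>
  With \<open>G\<close> the permutation matrix of the involution \<open>\<tau>\<close>, this is \<open>(1 + z)/2 + (1 - z)/2 G\<close>: it acts
  as \<open>1\<close> and as \<open>z\<close> on the eigenspaces of \<open>G\<close> for \<open>1\<close> and \<open>-1\<close>. For \<open>z\<close> on the unit circle
  it is a polynomial path of unitary matrices from the identity at \<open>z = 1\<close> to \<open>G\<close> at \<open>z = -1\<close>.
\<close>

definition involution_path :: "nat \<Rightarrow> (nat \<Rightarrow> nat) \<Rightarrow> complex \<Rightarrow> complex mat" where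
  "involution_path n \<tau> z = Matrix.mat n n
     (\<lambda>(i,j). (if j = i then (1 + z) / 2 else 0) + (if j = \<tau> i then (1 - z) / 2 else 0))"

lemma involution_path_carrier [simp]: "involution_path n \<tau> z \<in> carrier_mat n n"
  by (simp add: involution_path_def)

lemma involution_path_mult_index:
  assumes "W \<in> carrier_mat n m" "i < n" "\<tau> i < n" "j < m"
  shows "(involution_path n \<tau> z * W) $$ (i,j) = (1 + z) / 2 * W $$ (i,j) + (1 - z) / 2 * W $$ (\<tau> i, j)"
proof -
  have "(involution_path n \<tau> z * W) $$ (i,j) = (\<Sum>q<n. (if q = i then (1 + z) / 2 * W $$ (q,j) else 0)
      + (if q = \<tau> i then (1 - z) / 2 * W $$ (q,j) else 0))"
    using assms by (subst mult_mat_index[OF involution_path_carrier assms(1)])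
      (simp_all add: involution_path_def distrib_right if_distribR if_distrib[of "\<lambda>x. x * _"] cong: if_cong)
  also have "\<dots> = (1 + z) / 2 * W $$ (i,j) + (1 - z) / 2 * W $$ (\<tau> i, j)"
    using assms unfolding sum.distrib by (simp add: sum.delta del: distrib_right_numeral)
  finally show ?thesis .
qed

lemma involution_path_unitary:
  assumes \<tau>: "\<And>i. i < n \<Longrightarrow> \<tau> i < n" "\<And>i. \<tau> (\<tau> i) = i" and z: "cmod z = 1"
  shows "involution_path n \<tau> z \<in> unitary_group n"
proof -
  have prod: "involution_path n \<tau> z * involution_path n \<tau> w = 1\<^sub>m n" if "z * w = 1" for z w
  proof (rule eq_matI)
    fix i j assume "i < dim_row (1\<^sub>m n :: complex mat)" "j < dim_col (1\<^sub>m n :: complex mat)"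
    then have ij: "i < n" "j < n" by auto
    have eq: "(1 + z) / 2 * ((1 + w) / 2) + (1 - z) / 2 * ((1 - w) / 2) = 1"
      "(1 + z) / 2 * ((1 - w) / 2) + (1 - z) / 2 * ((1 + w) / 2) = 0"
      using that by (simp_all add: field_simps)
    have split: "a * ((if j = i then c else 0) + (if j = \<tau> i then d else 0))
        + b * ((if j = \<tau> i then c else 0) + (if j = i then d else 0))
      = (a * c + b * d) * (if j = i then 1 else 0) + (a * d + b * c) * (if j = \<tau> i then 1 else 0)"
      for a b c d :: complex by (auto simp: algebra_simps)
    have "(involution_path n \<tau> z * involution_path n \<tau> w) $$ (i,j)
      = ((1 + z) / 2 * ((1 + w) / 2) + (1 - z) / 2 * ((1 - w) / 2)) * (if j = i then 1 else 0)
      + ((1 + z) / 2 * ((1 - w) / 2) + (1 - z) / 2 * ((1 + w) / 2)) * (if j = \<tau> i then 1 else 0)"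
      unfolding split[symmetric] using ij \<tau>
      by (subst involution_path_mult_index[OF involution_path_carrier])
        (simp_all add: involution_path_def)
    then show "(involution_path n \<tau> z * involution_path n \<tau> w) $$ (i,j) = 1\<^sub>m n $$ (i,j)"
      unfolding eq using ij by simp
  qed (simp_all add: involution_path_def)
  have adj: "mat_adjoint (involution_path n \<tau> z) = involution_path n \<tau> (cnj z)"
  proof (rule eq_matI)
    fix i j assume "i < dim_row (involution_path n \<tau> (cnj z))" "j < dim_col (involution_path n \<tau> (cnj z))"
    then have ij: "i < n" "j < n" by (auto simp: involution_path_def)
    have "i = \<tau> j \<longleftrightarrow> j = \<tau> i" using \<tau>(2) by metis
    then show "mat_adjoint (involution_path n \<tau> z) $$ (i,j) = involution_path n \<tau> (cnj z) $$ (i,j)"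
      using ij by (subst mat_adjoint_index[OF involution_path_carrier])
        (auto simp: involution_path_def)
  qed (use mat_adjoint_carrier[OF involution_path_carrier[of n \<tau> z]]
        involution_path_carrier[of n \<tau> "cnj z"] in \<open>simp_all only: carrier_matD\<close>)
  have "z * cnj z = 1" using z by (simp add: complex_norm_square[symmetric])
  then show ?thesis
    using prod[of z "cnj z"] prod[of "cnj z" z] by (simp add: unitary_group_def adj mult.commute)
qed

lemma entry_measurable:
  assumes "i < n" "j < n"
  shows "(\<lambda>W. W $$ (i,j)) \<in> borel_measurable (unitary_borel n)"
proof -
  let ?I = "{..<n} \<times> {..<n}"
  let ?f = "\<lambda>V :: complex mat. \<lambda>ij\<in>?I. V $$ ij"
  have "?f \<in> measurable (unitary_borel n) (Pi\<^sub>M ?I (\<lambda>_. borel))"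
    unfolding unitary_borel_def by (rule measurable_vimage_algebra1) (auto simp: space_PiM)
  then have "(\<lambda>V. ?f V (i,j)) \<in> borel_measurable (unitary_borel n)"
    by (rule measurable_compose) (use assms in \<open>auto intro: measurable_component_singleton\<close>)
  then show ?thesis using assms by simp
qed

lemma space_unitary_borel [simp]: "space (unitary_borel n) = unitary_group n"
  by (simp add: unitary_borel_def)

lemma unitary_group_carrier: "W \<in> unitary_group n \<Longrightarrow> W \<in> carrier_mat n n"
  by (simp add: unitary_group_def)

lemma left_mult_measurable:
  assumes V: "V \<in> unitary_group n"
  shows "(\<lambda>W. V * W) \<in> measurable (unitary_borel n) (unitary_borel n)"
proof -
  let ?I = "{..<n} \<times> {..<n}"
  have "(\<lambda>W. \<lambda>ij\<in>?I. (V * W) $$ ij) \<in> measurable (unitary_borel n) (Pi\<^sub>M ?I (\<lambda>_. borel))"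
  proof (rule measurable_restrict)
    fix ij assume "ij \<in> ?I"
    then obtain i j where ij: "ij = (i,j)" "i < n" "j < n" by auto
    have "(\<lambda>W. \<Sum>q<n. V $$ (i,q) * W $$ (q,j)) \<in> borel_measurable (unitary_borel n)"
      using ij by (intro borel_measurable_sum borel_measurable_times borel_measurable_const entry_measurable) auto
    then show "(\<lambda>W. (V * W) $$ ij) \<in> borel_measurable (unitary_borel n)"
      by (rule subst[OF measurable_cong, rotated])
         (simp add: ij mult_mat_index[OF unitary_group_carrier[OF V] unitary_group_carrier] del: index_mult_mat)
  qed
  then show ?thesis
    by (subst (2) unitary_borel_def, intro measurable_vimage_algebra2)
       (use unitary_group_mult[OF V] in auto)
qed

locale haar_unitary =
  fixes n :: nat and \<mu> :: "complex mat measure"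
  assumes haar: "haar_unitary_measure n \<mu>"
begin

sublocale prob_space \<mu>
  using haar by (simp add: haar_unitary_measure_def)

lemma sets_haar [measurable_cong]: "sets \<mu> = sets (unitary_borel n)"
  using haar by (simp add: haar_unitary_measure_def)

lemma space_haar: "space \<mu> = unitary_group n"
  using sets_eq_imp_space_eq[OF sets_haar] by simp

lemma distr_left_mult: "V \<in> unitary_group n \<Longrightarrow> distr \<mu> (unitary_borel n) (\<lambda>W. V * W) = \<mu>"
  using haar by (simp add: haar_unitary_measure_def)

lemma left_mult_measurable_haar:
  "V \<in> unitary_group n \<Longrightarrow> (\<lambda>W. V * W) \<in> measurable \<mu> (unitary_borel n)"
  using left_mult_measurable measurable_cong_sets[OF sets_haar refl] by blast

lemma measure_left_mult:
  assumes V: "V \<in> unitary_group n" and E: "E \<in> sets \<mu>"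
  shows "{W \<in> space \<mu>. V * W \<in> E} \<in> sets \<mu>" "measure \<mu> {W \<in> space \<mu>. V * W \<in> E} = measure \<mu> E"
proof -
  have eq: "{W \<in> space \<mu>. V * W \<in> E} = (\<lambda>W. V * W) -` E \<inter> space \<mu>" by auto
  have E': "E \<in> sets (unitary_borel n)" using E sets_haar by simp
  show "{W \<in> space \<mu>. V * W \<in> E} \<in> sets \<mu>"
    unfolding eq using left_mult_measurable_haar[OF V] E' by (rule measurable_sets)
  show "measure \<mu> {W \<in> space \<mu>. V * W \<in> E} = measure \<mu> E"
    unfolding eq using measure_distr[OF left_mult_measurable_haar[OF V] E'] distr_left_mult[OF V] by simp
qed

lemma integral_left_mult:
  fixes f :: "complex mat \<Rightarrow> real"
  assumes V: "V \<in> unitary_group n" and f: "f \<in> borel_measurable (unitary_borel n)"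
  shows "(\<integral>W. f (V * W) \<partial>\<mu>) = (\<integral>W. f W \<partial>\<mu>)"
  using integral_distr[OF left_mult_measurable_haar[OF V] f] distr_left_mult[OF V] by simp

end

text \<open>
  Rows may repeat in \<open>g\<close> and come in any order, so that all terms in the expansion of a determinant
  of a matrix product have this form.
\<close>

definition row_minor :: "nat \<Rightarrow> (nat \<Rightarrow> nat) \<Rightarrow> complex mat \<Rightarrow> complex" where
  "row_minor r g W = Determinant.det (Matrix.mat r r (\<lambda>(i,j). W $$ (g i, j)))"

lemma row_minor_cong: "(\<And>i. i < r \<Longrightarrow> g i = h i) \<Longrightarrow> row_minor r g W = row_minor r h W"
  unfolding row_minor_def by (intro arg_cong[where f = Determinant.det] cong_mat) auto

lemma row_minor_measurable:
  assumes "\<And>i. i < r \<Longrightarrow> g i < n" "r \<le> n"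
  shows "row_minor r g \<in> borel_measurable (unitary_borel n)"
proof -
  have "row_minor r g = (\<lambda>W. \<Sum>p\<in>{p. p permutes {0..<r}}. signof p * (\<Prod>i=0..<r. W $$ (g i, p i)))"
  proof
    fix W
    show "row_minor r g W = (\<Sum>p\<in>{p. p permutes {0..<r}}. signof p * (\<Prod>i=0..<r. W $$ (g i, p i)))"
      unfolding row_minor_def
      by (subst det_def'[of _ r]) (auto simp: permutes_in_image[of _ "{0..<r}"] intro!: sum.cong prod.cong)
  qed
  moreover have "(\<lambda>W. W $$ (g i, p i)) \<in> borel_measurable (unitary_borel n)"
    if "p permutes {0..<r}" "i \<in> {0..<r}" for p i
    using that assms permutes_in_image[OF that(1), of i] less_le_trans[of "p i" r n] by (intro entry_measurable) auto
  ultimately show ?thesis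
    by (auto intro!: borel_measurable_sum borel_measurable_times borel_measurable_prod)
qed

text \<open>
  Along the path the minor is a polynomial in \<open>z\<close>. Permuting the rows by \<open>\<tau>\<close> multiplies the path
  by \<open>G\<close>, which is the substitution of \<open>- z\<close> for \<open>z\<close>.
\<close>

lemma row_minor_involution_path:
  assumes W: "W \<in> carrier_mat n n" and g: "\<And>i. i < r \<Longrightarrow> g i < n" "r \<le> n"
    and \<tau>: "\<And>i. i < n \<Longrightarrow> \<tau> i < n" "\<And>i. \<tau> (\<tau> i) = i"
  shows "\<exists>p. \<forall>z. row_minor r g (involution_path n \<tau> z * W) = poly p z \<and>
    row_minor r (\<tau> \<circ> g) (involution_path n \<tau> z * W) = poly p (- z)"
proof -
  define A where "A = Matrix.mat r r (\<lambda>(i,j).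
    [:(W $$ (g i,j) + W $$ (\<tau> (g i),j)) / 2, (W $$ (g i,j) - W $$ (\<tau> (g i),j)) / 2:])"
  have eval: "poly (Determinant.det A) z = Determinant.det (map_mat (\<lambda>p. poly p z) A)" for z
  proof -
    have "comm_ring_hom (\<lambda>p :: complex poly. poly p z)" by unfold_locales auto
    from comm_ring_hom.hom_det[OF this] show ?thesis by simp
  qed
  show ?thesis
  proof (intro exI[of _ "Determinant.det A"] allI conjI)
    fix z
    show "row_minor r g (involution_path n \<tau> z * W) = poly (Determinant.det A) z"
      unfolding eval row_minor_def
      by (intro arg_cong[where f = Determinant.det] eq_matI)
        (use g \<tau> in \<open>auto simp: A_def involution_path_mult_index[OF W] field_simps simp del: index_mult_mat\<close>)
    show "row_minor r (\<tau> \<circ> g) (involution_path n \<tau> z * W) = poly (Determinant.det A) (- z)"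
      unfolding eval row_minor_def
      by (intro arg_cong[where f = Determinant.det] eq_matI)
        (use g \<tau> in \<open>auto simp: A_def involution_path_mult_index[OF W] field_simps simp del: index_mult_mat\<close>)
  qed
qed

context haar_unitary
begin

text \<open>
  Let \<open>E\<close> be the event that the implication fails. Its preimages under the left multiplications by
  \<open>involution_path n \<tau> z\<close>, \<open>z\<close> on the unit circle, all have the probability of \<open>E\<close>. But a fixed
  \<open>W\<close> lies in only finitely many of them: lying in one shows that the polynomial
  \<open>z \<mapsto> row_minor r g (involution_path n \<tau> z * W)\<close> is not zero, and lying in the one for \<open>z\<close> makes
  \<open>z\<close> a root of it. Infinitely many events of equal probability with empty limit superior
  have probability zero.
\<close>

lemma AE_row_minor_involution:
  assumes g: "\<And>i. i < r \<Longrightarrow> g i < n" "r \<le> n"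
    and \<tau>: "\<And>i. i < n \<Longrightarrow> \<tau> i < n" "\<And>i. \<tau> (\<tau> i) = i"
  shows "AE W in \<mu>. row_minor r g W = 0 \<longrightarrow> row_minor r (\<tau> \<circ> g) W = 0"
proof -
  let ?V = "involution_path n \<tau>"
  define E where "E = {W \<in> space \<mu>. row_minor r g W = 0 \<and> row_minor r (\<tau> \<circ> g) W \<noteq> 0}"
  \<comment> \<open>any infinite sequence of distinct points of the unit circle would do\<close>
  define z where "z = (\<lambda>k :: nat. cis (1 / real (Suc k)))"
  define A where "A = (\<lambda>k. {W \<in> space \<mu>. ?V (z k) * W \<in> E})"
  define B where "B = (\<lambda>m. \<Union>k\<in>{m..}. A k)"
  have [measurable]: "row_minor r g \<in> borel_measurable \<mu>" "row_minor r (\<tau> \<circ> g) \<in> borel_measurable \<mu>"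
    using row_minor_measurable[of r g n] row_minor_measurable[of r "\<tau> \<circ> g" n] g \<tau>(1)
    by (simp_all add: measurable_cong_sets[OF sets_haar refl])
  have E: "E \<in> sets \<mu>" unfolding E_def by measurable
  have V: "?V (z k) \<in> unitary_group n" for k
    by (rule involution_path_unitary) (use \<tau> in \<open>auto simp: z_def\<close>)
  have A: "A k \<in> sets \<mu>" "measure \<mu> (A k) = measure \<mu> E" for k
    unfolding A_def using measure_left_mult[OF V E] by auto
  have "inj z"
  proof (rule injI)
    fix k m assume "z k = z m"
    then have "cos (1 / real (Suc k)) = cos (1 / real (Suc m))"
      by (metis cis.simps(1) z_def)
    moreover have range: "0 \<le> 1 / real (Suc q)" "1 / real (Suc q) \<le> pi" for q
    proof -
      have "1 / real (Suc q) \<le> 1" by simp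
      then show "1 / real (Suc q) \<le> pi" using pi_ge_two by linarith
    qed simp
    ultimately have "1 / real (Suc k) = 1 / real (Suc m)"
      using cos_inj_pi[OF range range] by blast
    then show "k = m" by simp
  qed
  \<comment> \<open>a nonzero polynomial has finitely many roots\<close>
  have fin: "finite {k. W \<in> A k}" if W: "W \<in> space \<mu>" for W
  proof (cases "{k. W \<in> A k} = {}")
    case False
    then obtain k where k: "W \<in> A k" by auto
    have "W \<in> carrier_mat n n" using W space_haar by (simp add: unitary_group_carrier)
    then obtain p where p: "\<And>z. row_minor r g (?V z * W) = poly p z"
      "\<And>z. row_minor r (\<tau> \<circ> g) (?V z * W) = poly p (- z)"
      using row_minor_involution_path[where g = g and r = r and \<tau> = \<tau>, OF _ g \<tau>] by blast
    have "poly p (- z k) \<noteq> 0" using k p by (auto simp: A_def E_def)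
    then have "finite {x. poly p x = 0}" by (intro poly_roots_finite) auto
    then have "finite (z -` {x. poly p x = 0})" using \<open>inj z\<close> by (rule finite_vimageI)
    then show ?thesis by (rule finite_subset[rotated]) (auto simp: A_def E_def p)
  qed simp
  have "(\<Inter>m. B m) = {}"
  proof (rule ccontr)
    assume "(\<Inter>m. B m) \<noteq> {}"
    then obtain W where W: "\<And>m. W \<in> B m" by auto
    then have "W \<in> space \<mu>" by (auto simp: B_def A_def)
    then obtain m where "{k. W \<in> A k} \<subseteq> {..m}" using fin finite_nat_iff_bounded_le by blast
    with W[of "Suc m"] show False by (auto simp: B_def)
  qed
  moreover have "decseq B" unfolding B_def by (intro decseq_SucI UN_mono) auto
  moreover have B: "B m \<in> sets \<mu>" for m using A(1) by (auto simp: B_def)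
  ultimately have "(\<lambda>m. measure \<mu> (B m)) \<longlonglongrightarrow> measure \<mu> {}"
    using finite_Lim_measure_decseq[of B] by auto
  then have "(\<lambda>m. measure \<mu> (B m)) \<longlonglongrightarrow> 0" by simp
  moreover have "measure \<mu> E \<le> measure \<mu> (B m)" for m
    unfolding A(2)[of m, symmetric] by (intro finite_measure_mono B) (auto simp: B_def)
  ultimately have "measure \<mu> E \<le> 0" by (intro LIMSEQ_le_const) auto
  then have "emeasure \<mu> E = 0" by (simp add: emeasure_eq_measure measure_le_0_iff)
  then show ?thesis using E by (intro AE_I[of _ _ E]) (auto simp: E_def)
qed

text \<open>
  Any injective choice of rows is reached from any other by transpositions, each of which
  corrects one index without spoiling those that agree already.
\<close>

lemma AE_row_minor_propagates:
  assumes g: "\<And>i. i < r \<Longrightarrow> g i < n" "inj_on g {..<r}" and h: "\<And>i. i < r \<Longrightarrow> h i < n" "inj_on h {..<r}"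
    and r: "r \<le> n"
  shows "AE W in \<mu>. row_minor r g W = 0 \<longrightarrow> row_minor r h W = 0"
  using g
proof (induction "card {i. i < r \<and> g i \<noteq> h i}" arbitrary: g rule: less_induct)
  case less
  show ?case
  proof (cases "\<forall>i<r. g i = h i")
    case True
    then show ?thesis using row_minor_cong[of r g h] by simp
  next
    case False
    then obtain i where i: "i < r" "g i \<noteq> h i" by auto
    define \<tau> where "\<tau> = Transposition.transpose (g i) (h i)"
    have \<tau>: "\<tau> q < n" if "q < n" for q
      using that less.prems(1) h(1) i by (auto simp: \<tau>_def Transposition.transpose_def)
    have \<tau>2: "\<tau> (\<tau> q) = q" for q by (simp add: \<tau>_def)
    have agree: "(\<tau> \<circ> g) q = h q" if "q < r" "g q = h q" for q
    proof -
      have "q \<noteq> i" using that i by auto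
      then have "g q \<noteq> g i" "h q \<noteq> h i"
        using that(1) i(1) less.prems(2) h(2) by (auto simp: inj_on_def)
      then show ?thesis using that(2) by (simp add: \<tau>_def Transposition.transpose_def)
    qed
    have "(\<tau> \<circ> g) i = h i" by (simp add: \<tau>_def)
    then have "{q. q < r \<and> (\<tau> \<circ> g) q \<noteq> h q} \<subset> {q. q < r \<and> g q \<noteq> h q}"
      using agree i by blast
    then have "card {q. q < r \<and> (\<tau> \<circ> g) q \<noteq> h q} < card {q. q < r \<and> g q \<noteq> h q}"
      by (intro psubset_card_mono) auto
    moreover have "inj_on (\<tau> \<circ> g) {..<r}"
      using less.prems(2) by (rule comp_inj_on) (metis \<tau>2 inj_onI)
    ultimately have "AE W in \<mu>. row_minor r (\<tau> \<circ> g) W = 0 \<longrightarrow> row_minor r h W = 0"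
      using less.prems(1) \<tau> by (intro less.hyps) auto
    moreover have "AE W in \<mu>. row_minor r g W = 0 \<longrightarrow> row_minor r (\<tau> \<circ> g) W = 0"
      by (rule AE_row_minor_involution[OF less.prems(1) r \<tau> \<tau>2])
    ultimately show ?thesis by eventually_elim blast
  qed
qed

end

text \<open>
  The Gram matrix of the first \<open>r\<close> columns is the identity. Expanding its determinant by linearity
  in each row gives a linear combination of row minors, so these are not all zero. The
  condition that \<open>f\<close> is the identity outside \<open>{0..<r}\<close> keeps the choices finite in number.
\<close>

lemma unitary_nonzero_row_minor:
  assumes W: "W \<in> unitary_group n" and r: "r \<le> n"
  shows "\<exists>f\<in>{f. (\<forall>i\<in>{0..<r}. f i \<in> {0..<n}) \<and> (\<forall>i. i \<notin> {0..<r} \<longrightarrow> f i = i)}. row_minor r f W \<noteq> 0"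
proof -
  define row where "row = (\<lambda>s. Matrix.vec r (\<lambda>j. W $$ (s,j)))"
  define a where "a = (\<lambda>i s. cnj (W $$ (s,i)) \<cdot>\<^sub>v row s)"
  let ?F = "{f. (\<forall>i\<in>{0..<r}. f i \<in> {0..<n}) \<and> (\<forall>i. i \<notin> {0..<r} \<longrightarrow> f i = i)}"
  have a: "a i s \<in> carrier_vec r" for i s by (simp add: a_def row_def)
  have "mat\<^sub>r r r (\<lambda>i. finsum_vec TYPE(complex) r (a i) {0..<n}) = 1\<^sub>m r"
  proof (rule eq_matI)
    fix i j assume "i < dim_row (1\<^sub>m r :: complex mat)" "j < dim_col (1\<^sub>m r :: complex mat)"
    then have ij: "i < r" "j < r" by auto
    have "vec_index (finsum_vec TYPE(complex) r (a i) {0..<n}) j = (\<Sum>s\<in>{0..<n}. vec_index (a i s) j)"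
      by (rule index_finsum_vec) (use a ij in auto)
    also have "\<dots> = (\<Sum>s<n. cnj (W $$ (s,i)) * W $$ (s,j))"
      using ij by (simp add: a_def row_def lessThan_atLeast0)
    also have "\<dots> = (if i = j then 1 else 0)"
      using ij r by (intro unitary_columns_orthonormal[OF W]) auto
    finally show "mat\<^sub>r r r (\<lambda>i. finsum_vec TYPE(complex) r (a i) {0..<n}) $$ (i,j) = 1\<^sub>m r $$ (i,j)"
      using ij by simp
  qed simp_all
  then have "1 = Determinant.det (mat\<^sub>r r r (\<lambda>i. finsum_vec TYPE(complex) r (a i) {0..<n}))"
    by simp
  also have "\<dots> = (\<Sum>f\<in>?F. Determinant.det (mat\<^sub>r r r (\<lambda>i. a i (f i))))"
    by (rule det_linear_rows_sum) (use a in auto)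
  also have "\<dots> = (\<Sum>f\<in>?F. (\<Prod>i\<in>{0..<r}. cnj (W $$ (f i,i))) * row_minor r f W)"
  proof (intro sum.cong refl)
    fix f
    have "Determinant.det (mat\<^sub>r r r (\<lambda>i. a i (f i))) =
        (\<Prod>i\<in>{0..<r}. cnj (W $$ (f i,i))) * Determinant.det (mat\<^sub>r r r (\<lambda>i. row (f i)))"
      unfolding a_def by (rule det_rows_mul) (simp add: row_def)
    also have "mat\<^sub>r r r (\<lambda>i. row (f i)) = Matrix.mat r r (\<lambda>(i,j). W $$ (f i, j))"
      by (rule eq_matI) (auto simp: row_def)
    finally show "Determinant.det (mat\<^sub>r r r (\<lambda>i. a i (f i))) =
        (\<Prod>i\<in>{0..<r}. cnj (W $$ (f i,i))) * row_minor r f W"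
      by (simp add: row_minor_def)
  qed
  finally show ?thesis
    by (metis (no_types, lifting) mult_zero_right sum.neutral zero_neq_one)
qed

lemma row_minor_not_inj:
  assumes "\<not> inj_on f {..<r}"
  shows "row_minor r f W = 0"
proof -
  obtain i j where ij: "i < r" "j < r" "i \<noteq> j" "f i = f j" using assms by (auto simp: inj_on_def)
  show ?thesis unfolding row_minor_def
    by (rule det_identical_rows[of _ r i j]) (use ij in \<open>auto intro!: eq_vecI\<close>)
qed

context haar_unitary
begin

text \<open>
  Off a null set, vanishing of one minor forces vanishing of all of them, which no unitary matrix
  allows.
\<close>

lemma AE_row_minor_nonzero:
  assumes g: "\<And>i. i < r \<Longrightarrow> g i < n" "inj_on g {..<r}" and r: "r \<le> n"
  shows "AE W in \<mu>. row_minor r g W \<noteq> 0"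
proof -
  let ?F = "{f. (\<forall>i\<in>{0..<r}. f i \<in> {0..<n}) \<and> (\<forall>i. i \<notin> {0..<r} \<longrightarrow> f i = i)}"
  have "finite ?F" by (rule finite_bounded_functions) auto
  then have "AE W in \<mu>. \<forall>f\<in>?F. row_minor r g W = 0 \<longrightarrow> row_minor r f W = 0"
  proof (rule AE_finite_allI)
    fix f assume f: "f \<in> ?F"
    show "AE W in \<mu>. row_minor r g W = 0 \<longrightarrow> row_minor r f W = 0"
    proof (cases "inj_on f {..<r}")
      case True
      then show ?thesis using f by (intro AE_row_minor_propagates[OF g _ _ r]) auto
    qed (simp add: row_minor_not_inj)
  qed
  moreover have "AE W in \<mu>. W \<in> unitary_group n" using AE_space[of \<mu>] unfolding space_haar .
  ultimately show ?thesis
  proof eventually_elim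
    case (elim W)
    then show ?case using unitary_nonzero_row_minor[OF elim(2) r] by blast
  qed
qed

end

section \<open>Decay of a fixed entry\<close>

lemma unitary_entry_norm_le:
  assumes "W \<in> unitary_group n" "i < n" "j < n"
  shows "(\<Sum>s<n. cmod (W $$ (s,j)) ^ 2) = 1" "cmod (W $$ (i,j)) ^ 2 \<le> 1"
proof -
  have "complex_of_real (\<Sum>s<n. cmod (W $$ (s,j)) ^ 2) = (\<Sum>s<n. cnj (W $$ (s,j)) * W $$ (s,j))"
    unfolding of_real_sum by (intro sum.cong refl) (simp only: complex_norm_square mult.commute)
  also have "\<dots> = 1" using unitary_columns_orthonormal[OF assms(1,3,3)] by simp
  finally show sum: "(\<Sum>s<n. cmod (W $$ (s,j)) ^ 2) = 1" by (simp only: of_real_eq_1_iff)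
  show "cmod (W $$ (i,j)) ^ 2 \<le> 1"
    unfolding sum[symmetric] by (rule member_le_sum) (use assms in auto)
qed

text \<open>
  The two squared moduli on the left are \<open>s + t\<close> and \<open>s - t\<close>, where \<open>s\<close> is the mean of the squared
  moduli of \<open>x\<close> and \<open>y\<close>, and \<open>\<bar>t\<bar> \<le> \<bar>x\<bar> \<bar>y\<bar>\<close>. These linear combinations are the rows of
  \<open>involution_path\<close> at \<open>z = \<i>\<close>.
\<close>

lemma quarter_turn_fourth_powers:
  fixes x y :: complex
  shows "cmod ((1 + \<i>) / 2 * x + (1 - \<i>) / 2 * y) ^ 4 + cmod ((1 + \<i>) / 2 * y + (1 - \<i>) / 2 * x) ^ 4
    \<le> (cmod x ^ 4 + cmod y ^ 4) / 2 + 3 * (cmod x ^ 2 * cmod y ^ 2)"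
proof -
  let ?a = "cmod x ^ 2" and ?b = "cmod y ^ 2"
  define t where "t = Re x * Im y - Im x * Re y"
  have u: "cmod ((1 + \<i>) / 2 * x + (1 - \<i>) / 2 * y) ^ 2 = (?a + ?b) / 2 + t"
    and v: "cmod ((1 + \<i>) / 2 * y + (1 - \<i>) / 2 * x) ^ 2 = (?a + ?b) / 2 - t"
    unfolding cmod_power2 t_def by (simp, simp add: field_simps power2_eq_square)+
  have "?a * ?b - t\<^sup>2 = (Re x * Re y + Im x * Im y)\<^sup>2"
    unfolding cmod_power2 t_def by (simp add: power2_eq_square algebra_simps)
  then have t: "t\<^sup>2 \<le> ?a * ?b" by (smt (verit) zero_le_power2)
  have four: "c ^ 4 = (c ^ 2) ^ 2" for c :: real by simp
  show ?thesis unfolding four u v using t by (simp add: power2_eq_square field_simps)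
qed

context haar_unitary
begin

lemma moments_measurable:
  assumes "a < n" "b < n" "j < n"
  shows "(\<lambda>W. cmod (W $$ (a,j)) ^ p * cmod (W $$ (b,j)) ^ q) \<in> borel_measurable (unitary_borel n)"
    "(\<lambda>W. cmod (W $$ (a,j)) ^ p) \<in> borel_measurable (unitary_borel n)"
  using assms by (auto intro!: borel_measurable_times borel_measurable_power
      measurable_compose[OF _ borel_measurable_norm] entry_measurable)

lemma entry_norm_le_1:
  assumes "W \<in> space \<mu>" "a < n" "j < n"
  shows "cmod (W $$ (a,j)) \<le> 1"
  using unitary_entry_norm_le(2)[of W n a j] assms space_haar by (simp add: power_le_one_iff abs_square_le_1)

lemma moments_integrable:
  assumes "a < n" "b < n" "j < n"
  shows "integrable \<mu> (\<lambda>W. cmod (W $$ (a,j)) ^ p * cmod (W $$ (b,j)) ^ q)"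
    "integrable \<mu> (\<lambda>W. cmod (W $$ (a,j)) ^ p)"
proof -
  have "AE W in \<mu>. norm (cmod (W $$ (a,j)) ^ p * cmod (W $$ (b,j)) ^ q) \<le> 1"
    by (rule AE_I2) (use assms entry_norm_le_1 in \<open>auto intro!: mult_le_one power_le_one\<close>)
  then show "integrable \<mu> (\<lambda>W. cmod (W $$ (a,j)) ^ p * cmod (W $$ (b,j)) ^ q)"
    by (rule integrable_const_bound)
       (use moments_measurable(1)[OF assms] in \<open>simp add: measurable_cong_sets[OF sets_haar refl]\<close>)
  have "AE W in \<mu>. norm (cmod (W $$ (a,j)) ^ p) \<le> 1"
    by (rule AE_I2) (use assms entry_norm_le_1 in \<open>auto intro!: power_le_one\<close>)
  then show "integrable \<mu> (\<lambda>W. cmod (W $$ (a,j)) ^ p)"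
    by (rule integrable_const_bound)
       (use moments_measurable(2)[OF assms] in \<open>simp add: measurable_cong_sets[OF sets_haar refl]\<close>)
qed

lemma moment_row_independent:
  assumes "a < n" "b < n" "j < n"
  shows "(\<integral>W. cmod (W $$ (a,j)) ^ p \<partial>\<mu>) = (\<integral>W. cmod (W $$ (b,j)) ^ p \<partial>\<mu>)"
proof -
  define \<tau> where "\<tau> = Transposition.transpose a b"
  let ?V = "involution_path n \<tau> (- 1)"
  have \<tau>: "\<tau> q < n" if "q < n" for q
    using that assms by (auto simp: \<tau>_def Transposition.transpose_def)
  have V: "?V \<in> unitary_group n"
    by (rule involution_path_unitary) (use \<tau> in \<open>auto simp: \<tau>_def\<close>)
  have "(\<integral>W. cmod (W $$ (a,j)) ^ p \<partial>\<mu>) = (\<integral>W. cmod ((?V * W) $$ (a,j)) ^ p \<partial>\<mu>)"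
    using integral_left_mult[OF V moments_measurable(2)[OF assms]] by simp
  also have "\<dots> = (\<integral>W. cmod (W $$ (b,j)) ^ p \<partial>\<mu>)"
  proof (rule Bochner_Integration.integral_cong[OF refl])
    fix W assume "W \<in> space \<mu>"
    then have W: "W \<in> carrier_mat n n" using space_haar unitary_group_carrier by simp
    have "\<tau> a = b" by (simp add: \<tau>_def)
    then show "cmod ((?V * W) $$ (a,j)) ^ p = cmod (W $$ (b,j)) ^ p"
      using assms \<tau> by (subst involution_path_mult_index[OF W]) auto
  qed
  finally show ?thesis .
qed

lemma second_moment:
  assumes "a < n" "j < n"
  shows "(\<integral>W. cmod (W $$ (a,j)) ^ 2 \<partial>\<mu>) = 1 / n"
proof -
  have "real n * (\<integral>W. cmod (W $$ (a,j)) ^ 2 \<partial>\<mu>) = (\<Sum>b<n. \<integral>W. cmod (W $$ (a,j)) ^ 2 \<partial>\<mu>)"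
    by simp
  also have "\<dots> = (\<Sum>b<n. \<integral>W. cmod (W $$ (b,j)) ^ 2 \<partial>\<mu>)"
    using assms by (intro sum.cong refl moment_row_independent) auto
  also have "\<dots> = (\<integral>W. (\<Sum>b<n. cmod (W $$ (b,j)) ^ 2) \<partial>\<mu>)"
    using assms by (intro Bochner_Integration.integral_sum[symmetric] moments_integrable) auto
  also have "\<dots> = (\<integral>W. 1 \<partial>\<mu>)"
    using assms space_haar unitary_entry_norm_le(1)[of _ n a j]
    by (intro Bochner_Integration.integral_cong) auto
  also have "\<dots> = 1" using prob_space by simp
  finally show ?thesis using assms by (simp add: field_simps)
qed

text \<open>
  Mixing the rows \<open>a\<close> and \<open>b\<close> by a unitary matrix preserves the sum of their fourth moments, while
  \<open>quarter_turn_fourth_powers\<close> bounds the new sum by half the old one plus a mixed moment.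
\<close>

lemma fourth_moment_le_mixed:
  assumes "a < n" "b < n" "a \<noteq> b" "j < n"
  shows "(\<integral>W. cmod (W $$ (a,j)) ^ 4 \<partial>\<mu>) \<le> 3 * (\<integral>W. cmod (W $$ (a,j)) ^ 2 * cmod (W $$ (b,j)) ^ 2 \<partial>\<mu>)"
proof -
  define \<tau> where "\<tau> = Transposition.transpose a b"
  let ?V = "involution_path n \<tau> \<i>"
  let ?m = "\<integral>W. cmod (W $$ (a,j)) ^ 4 \<partial>\<mu>"
  let ?mix = "\<integral>W. cmod (W $$ (a,j)) ^ 2 * cmod (W $$ (b,j)) ^ 2 \<partial>\<mu>"
  let ?f = "\<lambda>W. cmod (W $$ (a,j)) ^ 4 + cmod (W $$ (b,j)) ^ 4"
  let ?h = "\<lambda>W. ?f W / 2 + 3 * (cmod (W $$ (a,j)) ^ 2 * cmod (W $$ (b,j)) ^ 2)"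
  have \<tau>: "\<tau> q < n" if "q < n" for q
    using that assms by (auto simp: \<tau>_def Transposition.transpose_def)
  have V: "?V \<in> unitary_group n"
    by (rule involution_path_unitary) (use \<tau> in \<open>auto simp: \<tau>_def\<close>)
  have int: "integrable \<mu> ?f" "integrable \<mu> ?h"
    using assms by (auto intro!: Bochner_Integration.integrable_add integrable_divide
        integrable_mult_right moments_integrable)
  have fm: "?f \<in> borel_measurable (unitary_borel n)"
    using assms by (intro borel_measurable_add moments_measurable) auto
  have b4: "(\<integral>W. cmod (W $$ (b,j)) ^ 4 \<partial>\<mu>) = ?m"
    using assms by (intro moment_row_independent) auto
  have f: "(\<integral>W. ?f W \<partial>\<mu>) = 2 * ?m"
    using assms b4 by (subst Bochner_Integration.integral_add) (auto intro!: moments_integrable)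
  have fV: "?f (?V * W) \<le> ?h W" if "W \<in> space \<mu>" for W
  proof -
    have W: "W \<in> carrier_mat n n" using that space_haar unitary_group_carrier by simp
    have "\<tau> a = b" "\<tau> b = a" by (simp_all add: \<tau>_def)
    then have "(?V * W) $$ (a,j) = (1 + \<i>) / 2 * W $$ (a,j) + (1 - \<i>) / 2 * W $$ (b,j)"
      "(?V * W) $$ (b,j) = (1 + \<i>) / 2 * W $$ (b,j) + (1 - \<i>) / 2 * W $$ (a,j)"
      using assms involution_path_mult_index[OF W, of a \<tau> j \<i>]
        involution_path_mult_index[OF W, of b \<tau> j \<i>] by simp_all
    then show ?thesis using quarter_turn_fourth_powers[of "W $$ (a,j)" "W $$ (b,j)"] by simp
  qed
  have intV: "integrable \<mu> (\<lambda>W. ?f (?V * W))"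
  proof -
    have "integrable (distr \<mu> (unitary_borel n) (\<lambda>W. ?V * W)) ?f"
      unfolding distr_left_mult[OF V] by (rule int)
    then show ?thesis by (subst (asm) integrable_distr_eq[OF left_mult_measurable_haar[OF V] fm])
  qed
  have "2 * ?m = (\<integral>W. ?f (?V * W) \<partial>\<mu>)" using integral_left_mult[OF V fm] f by simp
  also have "\<dots> \<le> (\<integral>W. ?h W \<partial>\<mu>)" using intV int(2) fV by (rule integral_mono)
  also have "\<dots> = (\<integral>W. ?f W / 2 \<partial>\<mu>) + (\<integral>W. 3 * (cmod (W $$ (a,j)) ^ 2 * cmod (W $$ (b,j)) ^ 2) \<partial>\<mu>)"
    using assms by (intro Bochner_Integration.integral_add integrable_divide int
        integrable_mult_right moments_integrable) auto
  also have "\<dots> = ?m + 3 * ?mix" using f by simp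
  finally show ?thesis by simp
qed

text \<open>
  Summing the comparison with mixed moments over \<open>b \<noteq> a\<close>, the mixed moments add up to at most the
  second moment because the column is a unit vector. The second moment alone would give a
  decay of order \<open>1 / n\<close>, which is not summable.
\<close>

lemma fourth_moment_bound:
  assumes "a < n" "j < n" "2 \<le> n"
  shows "(\<integral>W. cmod (W $$ (a,j)) ^ 4 \<partial>\<mu>) \<le> 6 / n ^ 2"
proof -
  let ?m = "\<integral>W. cmod (W $$ (a,j)) ^ 4 \<partial>\<mu>"
  let ?g = "\<lambda>b W. cmod (W $$ (a,j)) ^ 2 * cmod (W $$ (b,j)) ^ 2"
  let ?S = "{..<n} - {a}"
  have "real (n - 1) * ?m = (\<Sum>b\<in>?S. ?m)" using assms by simp
  also have "\<dots> \<le> (\<Sum>b\<in>?S. 3 * (\<integral>W. ?g b W \<partial>\<mu>))"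
    using assms by (intro sum_mono fourth_moment_le_mixed) auto
  also have "\<dots> = 3 * (\<integral>W. (\<Sum>b\<in>?S. ?g b W) \<partial>\<mu>)"
    using assms by (subst Bochner_Integration.integral_sum)
      (auto simp: sum_distrib_left intro!: moments_integrable)
  also have "(\<integral>W. (\<Sum>b\<in>?S. ?g b W) \<partial>\<mu>) \<le> (\<integral>W. cmod (W $$ (a,j)) ^ 2 \<partial>\<mu>)"
  proof (rule integral_mono)
    fix W assume "W \<in> space \<mu>"
    then have W: "W \<in> unitary_group n" using space_haar by simp
    have "(\<Sum>b\<in>?S. cmod (W $$ (b,j)) ^ 2) \<le> (\<Sum>b<n. cmod (W $$ (b,j)) ^ 2)"
      by (intro sum_mono2) auto
    also have "\<dots> = 1" using assms by (intro unitary_entry_norm_le(1)[OF W, of a]) auto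
    finally show "(\<Sum>b\<in>?S. ?g b W) \<le> cmod (W $$ (a,j)) ^ 2"
      unfolding sum_distrib_left[symmetric] by (intro mult_left_le) auto
  qed (use assms in \<open>auto intro!: Bochner_Integration.integrable_sum moments_integrable\<close>)
  also have "\<dots> = 1 / n" using assms by (intro second_moment)
  finally have "real (n - 1) * ?m \<le> 3 / n" by simp
  moreover have "?m \<ge> 0" by (intro integral_nonneg_AE) simp
  moreover have "real n / 2 \<le> real (n - 1)" using assms by simp
  ultimately have "real n / 2 * ?m \<le> 3 / n" by (meson mult_right_mono order_trans)
  then show ?thesis using assms by (simp add: field_simps power2_eq_square)
qed

end

text \<open>
  By monotone convergence the series of the \<open>X n\<close> is integrable, hence finite almost surely.
\<close>

lemma (in prob_space) AE_tendsto_0_of_summable_expectation: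
  fixes X :: "nat \<Rightarrow> 'a \<Rightarrow> real"
  assumes int: "\<And>n. integrable M (X n)" and nonneg: "\<And>n \<omega>. 0 \<le> X n \<omega>"
    and bound: "\<And>n. expectation (X n) \<le> c n" and c: "summable c"
  shows "AE \<omega> in M. (\<lambda>n. X n \<omega>) \<longlonglongrightarrow> 0"
proof -
  have [measurable]: "X n \<in> borel_measurable M" for n using int by (rule borel_measurable_integrable)
  have c0: "0 \<le> c n" for n
    using bound[of n] Bochner_Integration.integral_nonneg[of M "X n"] nonneg by (meson order_trans)
  have "(\<integral>\<^sup>+\<omega>. suminf (\<lambda>n. ennreal (X n \<omega>)) \<partial>M) = suminf (\<lambda>n. \<integral>\<^sup>+\<omega>. ennreal (X n \<omega>) \<partial>M)"
    by (rule nn_integral_suminf) simp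
  also have "\<dots> = suminf (\<lambda>n. ennreal (expectation (X n)))"
    by (intro suminf_cong nn_integral_eq_integral int) (simp add: nonneg)
  also have "\<dots> \<le> suminf (\<lambda>n. ennreal (c n))"
    by (intro suminf_le ennreal_leI bound) auto
  also have "\<dots> = ennreal (suminf c)" by (rule suminf_ennreal2[OF c0 c])
  also have "\<dots> < \<infinity>" by simp
  finally have "(\<integral>\<^sup>+\<omega>. suminf (\<lambda>n. ennreal (X n \<omega>)) \<partial>M) \<noteq> \<infinity>" by simp
  then have "AE \<omega> in M. suminf (\<lambda>n. ennreal (X n \<omega>)) \<noteq> \<infinity>"
    by (intro nn_integral_PInf_AE) auto
  then show ?thesis
  proof eventually_elim
    case (elim \<omega>)
    then have "summable (\<lambda>n. X n \<omega>)" by (intro summable_suminf_not_top nonneg) simp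
    then show ?case by (rule summable_LIMSEQ_zero)
  qed
qed

text \<open>
  The fourth moments are summable in \<open>n\<close>, so almost surely the fourth powers themselves are.
\<close>

lemma AE_haar_entry_tendsto_0:
  fixes U :: "nat \<Rightarrow> 'a \<Rightarrow> complex mat"
  assumes "prob_space M" and U: "\<And>n. n \<ge> m \<Longrightarrow> haar_unitary_rv M n (U n)"
    and m: "2 \<le> m" "i < m" "j < m"
  shows "AE \<omega> in M. (\<lambda>n. U n \<omega> $$ (i,j)) \<longlonglongrightarrow> 0"
proof -
  interpret prob_space M by fact
  \<comment> \<open>nothing is known about \<open>U n\<close> for \<open>n < m\<close>\<close>
  define X where "X = (\<lambda>n \<omega>. if n < m then 0 else cmod (U n \<omega> $$ (i,j)) ^ 4)"
  have X: "integrable M (X n) \<and> expectation (X n) \<le> 6 / n ^ 2" for n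
  proof (cases "n < m")
    case False
    then have meas: "U n \<in> measurable M (unitary_borel n)"
      and haar: "haar_unitary_measure n (distr M (unitary_borel n) (U n))"
      using U[of n] by (auto simp: haar_unitary_rv_def)
    interpret H: haar_unitary n "distr M (unitary_borel n) (U n)" by unfold_locales (rule haar)
    have ij: "i < n" "j < n" "2 \<le> n" using False m by auto
    note fm = H.moments_measurable(2)[OF ij(1,1,2), of 4]
    have eq: "X n = (\<lambda>\<omega>. cmod (U n \<omega> $$ (i,j)) ^ 4)" using False by (simp add: X_def)
    have "integrable M (X n)"
      using H.moments_integrable(2)[OF ij(1,1,2), of 4] unfolding eq
      by (subst (asm) integrable_distr_eq[OF meas fm])
    moreover have "expectation (X n) = (\<integral>W. cmod (W $$ (i,j)) ^ 4 \<partial>distr M (unitary_borel n) (U n))"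
      unfolding eq by (rule integral_distr[OF meas fm, symmetric])
    ultimately show ?thesis using H.fourth_moment_bound[OF ij] by simp
  qed (simp add: X_def)
  have "summable (\<lambda>n. 6 * inverse (real n ^ 2))"
    by (intro summable_mult inverse_power_summable) simp
  then have "summable (\<lambda>n. 6 / real n ^ 2)" by (simp add: divide_inverse)
  then have "AE \<omega> in M. (\<lambda>n. X n \<omega>) \<longlonglongrightarrow> 0"
    using X by (intro AE_tendsto_0_of_summable_expectation[where c = "\<lambda>n. 6 / real n ^ 2"])
      (auto simp: X_def)
  then show ?thesis
  proof eventually_elim
    case (elim \<omega>)
    have "eventually (\<lambda>n. X n \<omega> = cmod (U n \<omega> $$ (i,j)) ^ 4) sequentially"
      using eventually_ge_at_top[of m] by eventually_elim (simp add: X_def)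
    then have "(\<lambda>n. cmod (U n \<omega> $$ (i,j)) ^ 4) \<longlonglongrightarrow> 0" by (rule Lim_transform_eventually[OF elim])
    then have "(\<lambda>n. root 4 (cmod (U n \<omega> $$ (i,j)) ^ 4)) \<longlonglongrightarrow> root 4 0" by (rule tendsto_real_root)
    then have "(\<lambda>n. cmod (U n \<omega> $$ (i,j))) \<longlonglongrightarrow> 0" by (simp add: real_root_power_cancel)
    then show ?case by (simp only: tendsto_norm_zero_iff)
  qed
qed

section \<open>Continuity of eigenvalues\<close>

text \<open>
  Convergence of every coefficient is stable under the ring operations, hence under the expansion
  of a determinant, and can be tracked through the division by a linear factor.
\<close>

definition coeff_tendsto :: "(nat \<Rightarrow> complex poly) \<Rightarrow> complex poly \<Rightarrow> bool" where
  "coeff_tendsto p q \<longleftrightarrow> (\<forall>i. (\<lambda>n. poly.coeff (p n) i) \<longlonglongrightarrow> poly.coeff q i)"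

lemma coeff_tendsto_const: "coeff_tendsto (\<lambda>_. p) p"
  by (simp add: coeff_tendsto_def)

lemma coeff_tendsto_add:
  "coeff_tendsto p p' \<Longrightarrow> coeff_tendsto q q' \<Longrightarrow> coeff_tendsto (\<lambda>n. p n + q n) (p' + q')"
  by (auto simp: coeff_tendsto_def intro: tendsto_add)

lemma coeff_tendsto_mult:
  "coeff_tendsto p p' \<Longrightarrow> coeff_tendsto q q' \<Longrightarrow> coeff_tendsto (\<lambda>n. p n * q n) (p' * q')"
  by (auto simp: coeff_tendsto_def coeff_mult intro!: tendsto_sum tendsto_mult)

lemma coeff_tendsto_sum:
  "(\<And>x. x \<in> S \<Longrightarrow> coeff_tendsto (p x) (p' x)) \<Longrightarrow>
     coeff_tendsto (\<lambda>n. \<Sum>x\<in>S. p x n) (\<Sum>x\<in>S. p' x)"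
  by (auto simp: coeff_tendsto_def coeff_sum intro!: tendsto_sum)

lemma coeff_tendsto_prod:
  "(\<And>x. x \<in> S \<Longrightarrow> coeff_tendsto (p x) (p' x)) \<Longrightarrow>
     coeff_tendsto (\<lambda>n. \<Prod>x\<in>S. p x n) (\<Prod>x\<in>S. p' x)"
proof (induction S rule: infinite_finite_induct)
  case (insert x F)
  then show ?case by (simp add: coeff_tendsto_mult)
qed (simp_all add: coeff_tendsto_const)

lemma poly_tendsto_at:
  assumes "coeff_tendsto p q" "\<And>n. degree (p n) = d" "degree q = d"
  shows "(\<lambda>n. poly (p n) z) \<longlonglongrightarrow> poly q z"
  using assms by (auto simp: coeff_tendsto_def poly_altdef intro!: tendsto_sum tendsto_mult)

lemma coeff_linear_factor_Suc:
  "poly.coeff ([:- a, 1:] * p) (Suc i) = poly.coeff p i - a * poly.coeff p (Suc i)" for a :: complex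
  by simp

text \<open>
  The coefficients of the quotient are recovered from those of the product by descending
  recursion (Horner's scheme), which starts with zeros above the degree \<open>d\<close>.
\<close>

lemma coeff_tendsto_divide_linear:
  assumes conv: "coeff_tendsto (\<lambda>n. [:- \<mu> n, 1:] * p n) ([:- \<nu>, 1:] * q)"
    and \<mu>: "\<mu> \<longlonglongrightarrow> \<nu>"
    and deg: "\<And>n. degree (p n) = d" "degree q = d"
  shows "coeff_tendsto p q"
  unfolding coeff_tendsto_def
proof
  fix i
  show "(\<lambda>n. poly.coeff (p n) i) \<longlonglongrightarrow> poly.coeff q i"
  proof (induction "Suc d - i" arbitrary: i rule: less_induct)
    case less
    show ?case
    proof (cases "i \<le> d")
      case True
      then have IH: "(\<lambda>n. poly.coeff (p n) (Suc i)) \<longlonglongrightarrow> poly.coeff q (Suc i)"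
        by (intro less) auto
      have "(\<lambda>n. poly.coeff ([:- \<mu> n, 1:] * p n) (Suc i) + \<mu> n * poly.coeff (p n) (Suc i))
         \<longlonglongrightarrow> poly.coeff ([:- \<nu>, 1:] * q) (Suc i) + \<nu> * poly.coeff q (Suc i)"
        using conv unfolding coeff_tendsto_def by (intro tendsto_intros \<mu> IH) blast
      then show ?thesis by (simp only: coeff_linear_factor_Suc) simp
    next
      case False
      with deg have "poly.coeff (p n) i = 0" "poly.coeff q i = 0" for n
        by (auto intro!: coeff_eq_0)
      then show ?thesis by simp
    qed
  qed
qed

text \<open>
  The value at \<open>z\<close> is the product of the \<open>d\<close> distances to the roots, so they cannot all exceed its
  \<open>d\<close>-th root.
\<close>

lemma monic_has_root_near:
  fixes p :: "complex poly"
  assumes "degree p = d" "lead_coeff p = 1" "d > 0"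
  shows "\<exists>\<mu>. poly p \<mu> = 0 \<and> norm (z - \<mu>) ^ d \<le> norm (poly p z)"
proof (rule ccontr)
  assume far: "\<nexists>\<mu>. poly p \<mu> = 0 \<and> norm (z - \<mu>) ^ d \<le> norm (poly p z)"
  obtain xs where xs: "p = (\<Prod>a\<leftarrow>xs. [:- a, 1:])" "length xs = d"
    using fundamental_theorem_algebra_factorized[of p] assms by auto
  define c where "c = root d (norm (poly p z))"
  have c: "c \<ge> 0" "c ^ d = norm (poly p z)" using assms(3) by (auto simp: c_def)
  have "c < norm (z - a)" if "a \<in> set xs" for a
  proof -
    have "poly p a = 0" using that unfolding xs(1) by (auto simp: poly_prod_list prod_list_zero_iff)
    with far have "norm (poly p z) < norm (z - a) ^ d" by force
    then show ?thesis using c by (metis norm_ge_zero power_less_imp_less_base)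
  qed
  moreover have "c ^ length xs < (\<Prod>a\<leftarrow>xs. norm (z - a))"
    if "xs \<noteq> []" "\<forall>a\<in>set xs. c < norm (z - a)" for xs
    using that
  proof (induction xs rule: list_nonempty_induct)
    case (cons a xs)
    then have "c * c ^ length xs < norm (z - a) * (\<Prod>a\<leftarrow>xs. norm (z - a))"
      using c(1) by (intro mult_strict_mono) (auto intro: le_less_trans)
    then show ?case by simp
  qed auto
  moreover have "xs \<noteq> []" using xs(2) assms(3) by auto
  ultimately have "c ^ length xs < (\<Prod>a\<leftarrow>xs. norm (z - a))" by blast
  also have "\<dots> = norm (poly p z)"
    unfolding xs(1) by (induction xs) (simp_all add: norm_mult del: mult_pCons_left)
  finally show False using c xs(2) by simp
qed

text \<open>
  Continuity of roots, with the multiplicities kept by deflation: the polynomials \<open>p n\<close> take values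
  tending to zero at the limit root \<open>x d\<close>, so they have roots tending to it. Dividing these
  out leaves the same problem in degree one less.
\<close>

lemma convergent_root_labelling:
  assumes "coeff_tendsto p (\<Prod>i<d. [:- x i, 1:])"
    and "\<And>n. degree (p n) = d" and "\<And>n. lead_coeff (p n) = 1"
  shows "\<exists>ev. (\<forall>n. p n = (\<Prod>i<d. [:- ev n i, 1:])) \<and> (\<forall>i<d. (\<lambda>n. ev n i) \<longlonglongrightarrow> x i)"
  using assms
proof (induction d arbitrary: p)
  case 0
  have "p n = 1" for n
  proof -
    obtain c where "p n = [:c:]" using 0(2)[of n] by (auto elim: degree_eq_zeroE)
    with 0(3)[of n] show ?thesis by simp
  qed
  then show ?case by auto
next
  case (Suc d)
  let ?q = "\<Prod>i<Suc d. [:- x i, 1:]"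
  have deg: "degree (\<Prod>i<k. [:- x i, 1:]) = k" for k
    by (subst degree_prod_eq_sum_degree) auto
  have "\<exists>\<mu>. \<forall>n. poly (p n) (\<mu> n) = 0 \<and> norm (x d - \<mu> n) ^ Suc d \<le> norm (poly (p n) (x d))"
    using monic_has_root_near[OF Suc.prems(2,3)] by (intro choice) blast
  then obtain \<mu> where \<mu>: "\<And>n. poly (p n) (\<mu> n) = 0"
    "\<And>n. norm (x d - \<mu> n) ^ Suc d \<le> norm (poly (p n) (x d))" by blast
  have "(\<lambda>n. poly (p n) (x d)) \<longlonglongrightarrow> poly ?q (x d)"
    using Suc.prems(1,2) deg by (rule poly_tendsto_at)
  then have "(\<lambda>n. norm (poly (p n) (x d))) \<longlonglongrightarrow> 0"
    by (simp add: tendsto_norm_zero_iff)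
  then have "(\<lambda>n. norm (x d - \<mu> n) ^ Suc d) \<longlonglongrightarrow> 0"
    by (rule tendsto_sandwich[OF _ _ tendsto_const, rotated 2]) (use \<mu>(2) in auto)
  then have "(\<lambda>n. root (Suc d) (norm (x d - \<mu> n) ^ Suc d)) \<longlonglongrightarrow> root (Suc d) 0"
    by (rule tendsto_real_root)
  then have "(\<lambda>n. norm (x d - \<mu> n)) \<longlonglongrightarrow> 0"
    by (simp only: real_root_power_cancel[OF zero_less_Suc norm_ge_zero] real_root_zero)
  then have "(\<lambda>n. x d - \<mu> n) \<longlonglongrightarrow> 0" by (simp only: tendsto_norm_zero_iff)
  then have "(\<lambda>n. x d - (x d - \<mu> n)) \<longlonglongrightarrow> x d - 0" by (intro tendsto_intros)
  then have \<mu>_lim: "\<mu> \<longlonglongrightarrow> x d" by simp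
  have "\<exists>p'. \<forall>n. p n = [:- \<mu> n, 1:] * p' n"
    using \<mu>(1) by (intro choice) (auto simp: poly_eq_0_iff_dvd dvd_def)
  then obtain p' where p': "\<And>n. p n = [:- \<mu> n, 1:] * p' n" by blast
  have lc: "lead_coeff (p' n) = 1" for n
    using Suc.prems(3)[of n] unfolding p'[of n] lead_coeff_mult by simp
  have dg: "degree (p' n) = d" for n
  proof -
    have "p' n \<noteq> 0" using lc[of n] by auto
    then show ?thesis using Suc.prems(2)[of n] unfolding p'[of n] by (subst (asm) degree_mult_eq) auto
  qed
  have pe: "p = (\<lambda>n. [:- \<mu> n, 1:] * p' n)" using p' by auto
  have "coeff_tendsto p' (\<Prod>i<d. [:- x i, 1:])"
    by (rule coeff_tendsto_divide_linear[OF _ \<mu>_lim dg deg])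
       (use Suc.prems(1) in \<open>simp only: pe prod.lessThan_Suc mult.commute\<close>)
  from Suc.IH[OF this dg lc] obtain ev where
    ev: "\<And>n. p' n = (\<Prod>i<d. [:- ev n i, 1:])" "\<And>i. i < d \<Longrightarrow> (\<lambda>n. ev n i) \<longlonglongrightarrow> x i" by blast
  let ?ev = "\<lambda>n. (ev n)(d := \<mu> n)"
  have "(\<Prod>i<d. [:- ?ev n i, 1:]) = p' n" for n
    unfolding ev(1) by (intro prod.cong) auto
  then have "p n = (\<Prod>i<Suc d. [:- ?ev n i, 1:])" for n
    unfolding p' prod.lessThan_Suc by (simp only: fun_upd_same mult.commute)
  moreover have "(\<lambda>n. ?ev n i) \<longlonglongrightarrow> x i" if "i < Suc d" for i
    using that ev(2)[of i] \<mu>_lim by (cases "i = d") auto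
  ultimately show ?case by (intro exI[of _ ?ev] conjI allI impI)
qed

lemma proots_prod_linear:
  "proots (\<Prod>i<d. [:- a i, 1:]) = image_mset a (mset_set {..<d})" for a :: "nat \<Rightarrow> complex"
  by (subst proots_prod) (auto simp: sum_unfold_sum_mset)

lemma char_poly_coeff_tendsto:
  assumes X: "\<And>n. X n \<in> carrier_mat d d" and Y: "Y \<in> carrier_mat d d"
    and lim: "\<And>i j. i < d \<Longrightarrow> j < d \<Longrightarrow> (\<lambda>n. X n $$ (i,j)) \<longlonglongrightarrow> Y $$ (i,j)"
  shows "coeff_tendsto (\<lambda>n. char_poly (X n)) (char_poly Y)"
proof -
  have entry: "coeff_tendsto (\<lambda>n. char_poly_matrix (X n) $$ (i,j)) (char_poly_matrix Y $$ (i,j))"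
    if ij: "i < d" "j < d" for i j
  proof -
    have eq: "char_poly_matrix Z $$ (i,j) = (if i = j then [:0,1:] else 0) + [:- Z $$ (i,j):]"
      if "Z \<in> carrier_mat d d" for Z :: "complex mat"
      using that ij by (auto simp: char_poly_matrix_def)
    have "coeff_tendsto (\<lambda>n. [:- X n $$ (i,j):]) [:- Y $$ (i,j):]"
      using lim[OF ij] by (auto simp: coeff_tendsto_def coeff_pCons split: nat.split intro: tendsto_minus)
    then show ?thesis unfolding eq[OF X] eq[OF Y]
      by (intro coeff_tendsto_add coeff_tendsto_const)
  qed
  have det: "char_poly Z = (\<Sum>p\<in>{p. p permutes {0..<d}}. signof p * (\<Prod>i=0..<d. char_poly_matrix Z $$ (i, p i)))"
    if "Z \<in> carrier_mat d d" for Z :: "complex mat"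
    unfolding char_poly_def by (rule det_def') (use that in simp)
  show ?thesis unfolding det[OF X] det[OF Y]
    by (intro coeff_tendsto_sum coeff_tendsto_mult coeff_tendsto_const coeff_tendsto_prod entry)
       (auto simp: permutes_in_image)
qed

lemma proots_linear_factors: "proots (\<Prod>a\<in>#S. [:- a, 1:]) = S" for S :: "complex multiset"
proof (induction S)
  case (add a S)
  have "(\<Prod>a\<in>#S. [:- a, 1:]) \<noteq> 0" by (simp add: prod_mset_zero_iff image_iff)
  then have "proots ([:- a, 1:] * (\<Prod>a\<in>#S. [:- a, 1:])) = proots [:- a, 1:] + S"
    using add.IH by (subst proots_mult) simp_all
  then show ?case by (simp del: mult_pCons_left)
qed simp

lemma char_poly_eigenvalue_mset:
  assumes "Y \<in> carrier_mat d d"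
  shows "char_poly Y = (\<Prod>a\<in>#eigenvalue_mset Y. [:- a, 1:])" "size (eigenvalue_mset Y) = d"
proof -
  obtain S where S: "size S = degree (char_poly Y)"
    "char_poly Y = Polynomial.smult (lead_coeff (char_poly Y)) (\<Prod>a\<in>#S. [:- a, 1:])"
    using alg_closed_imp_factorization[of "char_poly Y"] char_poly_nonzero[OF assms] by auto
  then have Y: "char_poly Y = (\<Prod>a\<in>#S. [:- a, 1:])" "size S = d"
    using degree_monic_char_poly[OF assms] by simp_all
  then have "eigenvalue_mset Y = S" by (simp add: eigenvalue_mset_def proots_linear_factors)
  with Y show "char_poly Y = (\<Prod>a\<in>#eigenvalue_mset Y. [:- a, 1:])" "size (eigenvalue_mset Y) = d"
    by simp_all
qed

lemma convergent_eigenvalue_labelling: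
  assumes X: "\<And>n. X n \<in> carrier_mat d d" and Y: "Y \<in> carrier_mat d d"
    and lim: "\<And>i j. i < d \<Longrightarrow> j < d \<Longrightarrow> (\<lambda>n. X n $$ (i,j)) \<longlonglongrightarrow> Y $$ (i,j)"
    and x: "image_mset x (mset_set {..<d}) = eigenvalue_mset Y"
  shows "\<exists>ev. (\<forall>n. image_mset (ev n) (mset_set {..<d}) = eigenvalue_mset (X n)) \<and>
    (\<forall>i<d. (\<lambda>n. ev n i) \<longlonglongrightarrow> x i)"
proof -
  have Y': "char_poly Y = (\<Prod>i<d. [:- x i, 1:])"
    unfolding char_poly_eigenvalue_mset(1)[OF Y] x[symmetric]
    by (simp add: prod_unfold_prod_mset image_mset.compositionality o_def)
  have "coeff_tendsto (\<lambda>n. char_poly (X n)) (\<Prod>i<d. [:- x i, 1:])"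
    unfolding Y'[symmetric] by (rule char_poly_coeff_tendsto[OF X Y lim])
  from convergent_root_labelling[OF this] obtain ev where
    "\<forall>n. char_poly (X n) = (\<Prod>i<d. [:- ev n i, 1:])" "\<forall>i<d. (\<lambda>n. ev n i) \<longlonglongrightarrow> x i"
    using degree_monic_char_poly[OF X] by metis
  then show ?thesis by (intro exI[of _ ev]) (simp add: eigenvalue_mset_def proots_prod_linear)
qed

lemma multiset_indexed: "\<exists>x. image_mset x (mset_set {..<size S}) = S"
proof -
  obtain xs where xs: "mset xs = S" using ex_mset by blast
  have "image_mset ((!) xs) (mset_set {..<length xs}) = mset (map ((!) xs) [0..<length xs])"
    by (simp add: atLeast0LessThan)
  also have "map ((!) xs) [0..<length xs] = xs" by (rule map_nth)
  finally show ?thesis using xs by auto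
qed

section \<open>Convergence of the nontrivial eigenvalues\<close>

lemma mult_entry_tendsto:
  fixes X Y :: "nat \<Rightarrow> complex mat"
  assumes "\<And>n. X n \<in> carrier_mat d m" "X' \<in> carrier_mat d m"
    and "\<And>n. Y n \<in> carrier_mat m p" "Y' \<in> carrier_mat m p"
    and "\<And>i j. i < d \<Longrightarrow> j < m \<Longrightarrow> (\<lambda>n. X n $$ (i,j)) \<longlonglongrightarrow> X' $$ (i,j)"
    and "\<And>i j. i < m \<Longrightarrow> j < p \<Longrightarrow> (\<lambda>n. Y n $$ (i,j)) \<longlonglongrightarrow> Y' $$ (i,j)"
    and ij: "i < d" "j < p"
  shows "(\<lambda>n. (X n * Y n) $$ (i,j)) \<longlonglongrightarrow> (X' * Y') $$ (i,j)"
  unfolding mult_mat_index[OF assms(1,3) ij] mult_mat_index[OF assms(2,4) ij]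
  using assms(5,6) ij by (intro tendsto_sum tendsto_mult) auto

lemma four_block_entry_tendsto:
  fixes X1 X2 X3 X4 :: "nat \<Rightarrow> complex mat"
  assumes c: "\<And>n. X1 n \<in> carrier_mat r r" "\<And>n. X2 n \<in> carrier_mat r r"
      "\<And>n. X3 n \<in> carrier_mat r r" "\<And>n. X4 n \<in> carrier_mat r r"
    and c': "Y1 \<in> carrier_mat r r" "Y2 \<in> carrier_mat r r" "Y3 \<in> carrier_mat r r" "Y4 \<in> carrier_mat r r"
    and lim: "\<And>i j. i < r \<Longrightarrow> j < r \<Longrightarrow> (\<lambda>n. X1 n $$ (i,j)) \<longlonglongrightarrow> Y1 $$ (i,j)"
      "\<And>i j. i < r \<Longrightarrow> j < r \<Longrightarrow> (\<lambda>n. X2 n $$ (i,j)) \<longlonglongrightarrow> Y2 $$ (i,j)"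
      "\<And>i j. i < r \<Longrightarrow> j < r \<Longrightarrow> (\<lambda>n. X3 n $$ (i,j)) \<longlonglongrightarrow> Y3 $$ (i,j)"
      "\<And>i j. i < r \<Longrightarrow> j < r \<Longrightarrow> (\<lambda>n. X4 n $$ (i,j)) \<longlonglongrightarrow> Y4 $$ (i,j)"
    and ij: "i < 2 * r" "j < 2 * r"
  shows "(\<lambda>n. four_block_mat (X1 n) (X2 n) (X3 n) (X4 n) $$ (i,j)) \<longlonglongrightarrow>
    four_block_mat Y1 Y2 Y3 Y4 $$ (i,j)"
proof -
  have eq: "four_block_mat Z1 Z2 Z3 Z4 $$ (i,j) =
      (if i < r then if j < r then Z1 $$ (i,j) else Z2 $$ (i, j - r)
       else if j < r then Z3 $$ (i - r, j) else Z4 $$ (i - r, j - r))"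
    if "Z1 \<in> carrier_mat r r" "Z4 \<in> carrier_mat r r" for Z1 Z2 Z3 Z4 :: "complex mat"
    using that ij by auto
  show ?thesis unfolding eq[OF c(1,4)] eq[OF c'(1,4)] using lim ij by auto
qed

lemma nc_word_eval_tendsto:
  fixes X :: "nat \<Rightarrow> 'x \<Rightarrow> complex mat"
  assumes "\<And>n v. v \<in> set w \<Longrightarrow> X n v \<in> carrier_mat d d" "\<And>v. v \<in> set w \<Longrightarrow> Y v \<in> carrier_mat d d"
    and "\<And>v i j. v \<in> set w \<Longrightarrow> i < d \<Longrightarrow> j < d \<Longrightarrow> (\<lambda>n. X n v $$ (i,j)) \<longlonglongrightarrow> Y v $$ (i,j)"
    and "i < d" "j < d"
  shows "(\<lambda>n. nc_word_eval d (X n) w $$ (i,j)) \<longlonglongrightarrow> nc_word_eval d Y w $$ (i,j)"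
  using assms
proof (induction w arbitrary: i j)
  case (Cons v w)
  show ?case unfolding nc_word_eval_simps
    by (rule mult_entry_tendsto[of _ d d _ _ d])
       (use Cons in \<open>auto intro!: nc_word_eval_carrier\<close>)
qed simp

lemma nc_eval_tendsto:
  fixes X :: "nat \<Rightarrow> 'x \<Rightarrow> complex mat"
  assumes "nc_poly_over V P"
    and "\<And>n v. v \<in> V \<Longrightarrow> X n v \<in> carrier_mat d d" "\<And>v. v \<in> V \<Longrightarrow> Y v \<in> carrier_mat d d"
    and "\<And>v i j. v \<in> V \<Longrightarrow> i < d \<Longrightarrow> j < d \<Longrightarrow> (\<lambda>n. X n v $$ (i,j)) \<longlonglongrightarrow> Y v $$ (i,j)"
    and ij: "i < d" "j < d"
  shows "(\<lambda>n. nc_eval d (X n) P $$ (i,j)) \<longlonglongrightarrow> nc_eval d Y P $$ (i,j)"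
proof -
  have "(\<lambda>n. nc_word_eval d (X n) w $$ (i,j)) \<longlonglongrightarrow> nc_word_eval d Y w $$ (i,j)"
    if "w \<in> Poly_Mapping.keys P" for w
  proof -
    have "set w \<subseteq> V" using assms(1) that by (auto simp: nc_poly_over_def)
    then show ?thesis using assms by (intro nc_word_eval_tendsto) (auto simp: subset_iff)
  qed
  then show ?thesis using ij by (auto simp: nc_eval_def intro!: tendsto_sum tendsto_mult)
qed

text \<open>
  The block is a fixed noncommutative polynomial in matrices of fixed size, so it depends
  continuously on the truncation.
\<close>

lemma block_formula_tendsto:
  assumes A: "\<And>i. i < k \<Longrightarrow> A i \<in> carrier_mat r r" and B: "\<And>j. j < l \<Longrightarrow> B j \<in> carrier_mat r r"
    and P: "nc_poly_over ({..<k} <+> {..<l}) P"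
    and W: "\<And>n. W n \<in> carrier_mat r r" "W' \<in> carrier_mat r r"
    and lim: "\<And>i j. i < r \<Longrightarrow> j < r \<Longrightarrow> (\<lambda>n. W n $$ (i,j)) \<longlonglongrightarrow> W' $$ (i,j)"
    and ij: "i < 2 * r" "j < 2 * r"
  shows "(\<lambda>n. block_formula r A B P (W n) $$ (i,j)) \<longlonglongrightarrow> block_formula r A B P W' $$ (i,j)"
  unfolding block_formula_def
proof (rule nc_eval_tendsto[OF P _ _ _ ij], goal_cases)
  case (1 n v)
  then show ?case using A B mat_adjoint_carrier[OF W(1)[of n]] W(1)[of n]
    by (auto simp: mult_2 intro!: four_block_carrier_mat mult_carrier_mat[of _ r r])
next
  case (2 v)
  then show ?case using A B mat_adjoint_carrier[OF W(2)] W(2)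
    by (auto simp: mult_2 intro!: four_block_carrier_mat mult_carrier_mat[of _ r r])
next
  case (3 v a b)
  have adj: "(\<lambda>n. mat_adjoint (W n) $$ (a,b)) \<longlonglongrightarrow> mat_adjoint W' $$ (a,b)" if "a < r" "b < r" for a b
    unfolding mat_adjoint_index[OF W(1) that] mat_adjoint_index[OF W(2) that]
    using lim that by (intro tendsto_cnj) auto
  from 3(1) show ?case
  proof
    fix i assume v: "v = Inl i" "i \<in> {..<k}"
    note Ai = A[of i]
    have "(\<lambda>n. (A i * mat_adjoint (W n)) $$ (a,b)) \<longlonglongrightarrow> (A i * mat_adjoint W') $$ (a,b)"
      if "a < r" "b < r" for a b
      by (rule mult_entry_tendsto[of _ r r _ _ r]) (use v Ai W adj that in auto)
    moreover have "A i \<in> carrier_mat r r" using v Ai by simp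
    ultimately show ?case unfolding v(1) sum.case
      by (intro four_block_entry_tendsto[OF _ _ _ _ _ _ _ _ _ _ _ _ 3(2,3)]
          mult_carrier_mat[of _ r r] mat_adjoint_carrier W zero_carrier_mat tendsto_const)
  next
    fix j assume v: "v = Inr j" "j \<in> {..<l}"
    note Bj = B[of j]
    have "(\<lambda>n. (B j * W n) $$ (a,b)) \<longlonglongrightarrow> (B j * W') $$ (a,b)" if "a < r" "b < r" for a b
      by (rule mult_entry_tendsto[of _ r r _ _ r]) (use v Bj W lim that in auto)
    moreover have "B j \<in> carrier_mat r r" using v Bj by simp
    ultimately show ?case unfolding v(1) sum.case
      by (intro four_block_entry_tendsto[OF _ _ _ _ _ _ _ _ _ _ _ _ 3(2,3)]
          mult_carrier_mat[of _ r r] W zero_carrier_mat tendsto_const)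
  qed
qed

theorem theorem1p1:
  fixes r k l :: nat
    and A B :: "nat \<Rightarrow> complex mat"
    and P :: "(nat + nat) nc_poly"
    and M :: "'a measure"
    and U :: "nat \<Rightarrow> 'a \<Rightarrow> complex mat"
  assumes "r \<ge> 1" and "k \<ge> 1" and "l \<ge> 1"
    and "\<And>i. i < k \<Longrightarrow> A i \<in> carrier_mat r r"
    and "\<And>j. j < l \<Longrightarrow> B j \<in> carrier_mat r r"
    and "nc_poly_over ({..<k} <+> {..<l}) P"
    and "Poly_Mapping.lookup P [] = 0"
    and "prob_space M"
    and "\<And>N. N \<ge> 2 * r \<Longrightarrow> haar_unitary_rv M N (U N)"
  shows
    "(\<forall>N\<ge>2 * r. \<forall>\<omega>\<in>space M.
        replicate_mset (N - 2 * r) 0 \<subseteq># eigenvalue_mset (model_mat r A B P N (U N \<omega>))) \<and>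
     (AE \<omega> in M. \<forall>N\<ge>2 * r.
        invertible_mat (basis_mat r N (U N \<omega>)) \<and>
        nontrivial_block r A B P N (U N \<omega>) = block_formula r A B P (upper_left r (U N \<omega>)) \<and>
        eigenvalue_mset (model_mat r A B P N (U N \<omega>)) =
          nontrivial_eigenvalues r A B P N (U N \<omega>) + replicate_mset (N - 2 * r) 0) \<and>
     (\<exists>lim :: nat \<Rightarrow> complex.
        image_mset lim (mset_set {..<2 * r}) = eigenvalue_mset (deterministic_part r A B P) \<and>
        (AE \<omega> in M. \<exists>ev :: nat \<Rightarrow> nat \<Rightarrow> complex.
           (\<forall>N\<ge>2 * r. image_mset (ev N) (mset_set {..<2 * r}) =
              nontrivial_eigenvalues r A B P N (U N \<omega>)) \<and>
           (\<forall>i<2 * r. (\<lambda>N. ev N i) \<longlonglongrightarrow> lim i)))"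
proof -
  interpret prob_space M by fact
  note A = assms(4) and B = assms(5) and P = assms(6,7) and U = assms(9)
  let ?F = "block_formula r A B P"
  have unitary: "U N \<omega> \<in> unitary_group N" if "N \<ge> 2 * r" "\<omega> \<in> space M" for N \<omega>
  proof -
    have "U N \<in> measurable M (unitary_borel N)"
      using U[OF that(1)] by (simp add: haar_unitary_rv_def)
    from measurable_space[OF this that(2)] show ?thesis by simp
  qed
  have F: "?F W \<in> carrier_mat (2 * r) (2 * r)" for W by (simp add: block_formula_def nc_eval_def)
  have spectrum: "eigenvalue_mset (model_mat r A B P N (U N \<omega>)) =
      eigenvalue_mset (?F (upper_left r (U N \<omega>))) + replicate_mset (N - 2 * r) 0"
    and block: "invertible_mat (basis_mat r N (U N \<omega>)) \<Longrightarrow>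
      nontrivial_block r A B P N (U N \<omega>) = ?F (upper_left r (U N \<omega>))"
    if N: "N \<ge> 2 * r" and \<omega>: "\<omega> \<in> space M" for N \<omega>
  proof -
    obtain D where D: "D \<in> carrier_mat (2 * r) N"
      "model_mat r A B P N (U N \<omega>) = span_mat r N (U N \<omega>) * D"
      "?F (upper_left r (U N \<omega>)) = D * span_mat r N (U N \<omega>)"
      by (rule model_factorization[where A = A and B = B, OF unitary[OF N \<omega>] N A B P])
    show "eigenvalue_mset (model_mat r A B P N (U N \<omega>)) =
        eigenvalue_mset (?F (upper_left r (U N \<omega>))) + replicate_mset (N - 2 * r) 0"
      unfolding D(2,3) by (rule eigenvalue_mset_mult_commute[OF span_mat_carrier D(1) N])
    assume "invertible_mat (basis_mat r N (U N \<omega>))"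
    from nontrivial_block_eq[OF unitary[OF N \<omega>] N D(1,2) this]
    show "nontrivial_block r A B P N (U N \<omega>) = ?F (upper_left r (U N \<omega>))" unfolding D(3) .
  qed
  have zeros: "\<forall>N\<ge>2 * r. \<forall>\<omega>\<in>space M.
      replicate_mset (N - 2 * r) 0 \<subseteq># eigenvalue_mset (model_mat r A B P N (U N \<omega>))"
    by (simp add: spectrum)
  have "AE \<omega> in M. N \<ge> 2 * r \<longrightarrow> invertible_mat (basis_mat r N (U N \<omega>))" for N
  proof (cases "N \<ge> 2 * r")
    case N: True
    then have meas: "U N \<in> measurable M (unitary_borel N)"
      and haar: "haar_unitary_measure N (distr M (unitary_borel N) (U N))"
      using U[of N] by (auto simp: haar_unitary_rv_def)
    interpret H: haar_unitary N "distr M (unitary_borel N) (U N)" by unfold_locales (rule haar)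
    \<comment> \<open>the last \<open>r\<close> rows: the minor that decides the invertibility of \<open>basis_mat\<close>\<close>
    have "AE W in distr M (unitary_borel N) (U N). row_minor r (\<lambda>i. N - r + i) W \<noteq> 0"
      using N by (intro H.AE_row_minor_nonzero) (auto simp: inj_on_def)
    then have "AE \<omega> in M. row_minor r (\<lambda>i. N - r + i) (U N \<omega>) \<noteq> 0"
      by (rule AE_distrD[OF meas])
    then show ?thesis using AE_space
    proof eventually_elim
      case (elim \<omega>)
      then show ?case
        using basis_mat_invertible[OF unitary_group_carrier[OF unitary[OF N elim(2)]] N]
        by (simp add: row_minor_def)
    qed
  qed simp
  then have inv: "AE \<omega> in M. \<forall>N. N \<ge> 2 * r \<longrightarrow> invertible_mat (basis_mat r N (U N \<omega>))"
    by (simp only: AE_all_countable) simp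
  have struct: "AE \<omega> in M. \<forall>N\<ge>2 * r.
        invertible_mat (basis_mat r N (U N \<omega>)) \<and>
        nontrivial_block r A B P N (U N \<omega>) = ?F (upper_left r (U N \<omega>)) \<and>
        eigenvalue_mset (model_mat r A B P N (U N \<omega>)) =
          nontrivial_eigenvalues r A B P N (U N \<omega>) + replicate_mset (N - 2 * r) 0"
    using inv AE_space
  proof eventually_elim
    case (elim \<omega>)
    then show ?case by (simp add: nontrivial_eigenvalues_def block spectrum)
  qed
  have det: "deterministic_part r A B P \<in> carrier_mat (2 * r) (2 * r)"
    unfolding deterministic_part_def by (rule F)
  obtain x where x: "image_mset x (mset_set {..<2 * r}) = eigenvalue_mset (deterministic_part r A B P)"
    using multiset_indexed[of "eigenvalue_mset (deterministic_part r A B P)"]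
    unfolding char_poly_eigenvalue_mset(2)[OF det] by blast
  have "AE \<omega> in M. (\<lambda>N. U N \<omega> $$ (i,j)) \<longlonglongrightarrow> 0" if "i < r" "j < r" for i j
    by (rule AE_haar_entry_tendsto_0[of M "2 * r", OF assms(8) U]) (use that in auto)
  then have "AE \<omega> in M. \<forall>ij\<in>{..<r} \<times> {..<r}. (\<lambda>N. U N \<omega> $$ ij) \<longlonglongrightarrow> 0"
    by (intro AE_finite_allI) auto
  then have "AE \<omega> in M. \<exists>ev :: nat \<Rightarrow> nat \<Rightarrow> complex.
      (\<forall>N\<ge>2 * r. image_mset (ev N) (mset_set {..<2 * r}) = nontrivial_eigenvalues r A B P N (U N \<omega>)) \<and>
      (\<forall>i<2 * r. (\<lambda>N. ev N i) \<longlonglongrightarrow> x i)"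
    using struct
  proof eventually_elim
    case (elim \<omega>)
    \<comment> \<open>the limits do not see small \<open>N\<close>; the zero matrix keeps every term of the sequence of size \<open>r\<close>\<close>
    define W where "W = (\<lambda>N. if N \<ge> 2 * r then upper_left r (U N \<omega>) else 0\<^sub>m r r)"
    have W: "W N \<in> carrier_mat r r" for N by (simp add: W_def upper_left_def)
    have lim: "(\<lambda>N. W N $$ (i,j)) \<longlonglongrightarrow> 0\<^sub>m r r $$ (i,j)" if ij: "i < r" "j < r" for i j
    proof (rule Lim_transform_eventually)
      show "(\<lambda>N. U N \<omega> $$ (i,j)) \<longlonglongrightarrow> 0\<^sub>m r r $$ (i,j)" using elim(1) ij by simp
      show "eventually (\<lambda>N. U N \<omega> $$ (i,j) = W N $$ (i,j)) sequentially"
        using eventually_ge_at_top[of "2 * r"] by eventually_elim (simp add: W_def upper_left_def ij)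
    qed
    have "\<exists>ev. (\<forall>N. image_mset (ev N) (mset_set {..<2 * r}) = eigenvalue_mset (?F (W N))) \<and>
        (\<forall>i<2 * r. (\<lambda>N. ev N i) \<longlonglongrightarrow> x i)"
      by (rule convergent_eigenvalue_labelling[OF F det _ x])
         (unfold deterministic_part_def, rule block_formula_tendsto[OF A B P(1) W zero_carrier_mat lim])
    then obtain ev where "\<And>N. image_mset (ev N) (mset_set {..<2 * r}) = eigenvalue_mset (?F (W N))"
      "\<forall>i<2 * r. (\<lambda>N. ev N i) \<longlonglongrightarrow> x i" by blast
    moreover have "eigenvalue_mset (?F (W N)) = nontrivial_eigenvalues r A B P N (U N \<omega>)"
      if "N \<ge> 2 * r" for N
      using elim(2) that by (simp add: W_def nontrivial_eigenvalues_def)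
    ultimately show ?case by (intro exI[of _ ev]) simp
  qed
  with x have "\<exists>lim :: nat \<Rightarrow> complex.
      image_mset lim (mset_set {..<2 * r}) = eigenvalue_mset (deterministic_part r A B P) \<and>
      (AE \<omega> in M. \<exists>ev :: nat \<Rightarrow> nat \<Rightarrow> complex.
         (\<forall>N\<ge>2 * r. image_mset (ev N) (mset_set {..<2 * r}) =
            nontrivial_eigenvalues r A B P N (U N \<omega>)) \<and>
         (\<forall>i<2 * r. (\<lambda>N. ev N i) \<longlonglongrightarrow> lim i))"
    by (intro exI[of _ x] conjI)
  then show ?thesis by (intro conjI zeros struct)
qed

end
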